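(* Let $\mathbf p\in\mathbb{Z}^2$ be such that there exists $\mathbf q\in\mathbb{Z}^2$ with $$\|\mathbf q\|<\|\mathbf p\|,\qquad \|\mathbf q-\mathbf p\|=\|\mathbf p\|,\qquad \|\mathbf q+n\mathbf p\|>\|\mathbf p\|\ \text{ for all } n\in\mathbb{Z}\setminus\{-1,0\},$$ and let $\alpha\in\mathbb{R}$ be normalized by $\tfrac12\alpha(\mathbf q\wedge\mathbf p)\|\mathbf p\|^{-2}=1$. Let $L$ and $L_{\mathbf q}$ be the operators defined in the context. Then the eigenvalues of $L_{\mathbf q}$ with positive real parts are in one-to-one correspondence with the zeros (with positive real parts) of each of the five functions $\det(I-K_\lambda^+)$, $\det(I-\mathcal{T}_\lambda^+)$, $\mathcal{E}^+(\lambda)$, $\mathcal{F}^+(\lambda)$, $\mathcal{G}^+(\lambda)$ defined in the context; that is, $\lambda$ with $\operatorname{Re}(\lambda)>0$ is an eigenvalue of $L_{\mathbf q}$ if and only if it is a zero of each of these functions. Moreover, the operator $L_{\mathbf q}$, and thus $L$, has a positive eigenvalue. As a result, the unidirectional flow $\Omega^0(\mathbf x)=\alpha\cos(\mathbf p\cdot\mathbf x)$ is linearly unstable.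
   Context: Flow and linearization. On the torus $\mathbb{T}^2$ consider the Euler equations $\partial_t\Omega+U\cdot\nabla\Omega=0$, $\operatorname{div}U=0$, $\Omega=\operatorname{curl}U$, and the steady state (unidirectional, or generalized Kolmogorov, flow) $\Omega^0(\mathbf x)=\alpha\cos(\mathbf p\cdot\mathbf x)$. For $\mathbf p=(p_1,p_2),\mathbf q=(q_1,q_2)\in\mathbb{Z}^2$ let $\mathbf p\wedge\mathbf q=p_1q_2-p_2q_1$, and let $\beta(\mathbf p,\mathbf q)=\frac12\big(\|\mathbf q\|^{-2}-\|\mathbf p\|^{-2}\big)(\mathbf p\wedge\mathbf q)$ if $\mathbf p\ne0$, $\mathbf q\neq0$, and $\beta(\mathbf p,\mathbf q)=0$ otherwise ($\|\cdot\|$ is the Euclidean norm). The linearization about $\Omega^0$ in Fourier variables is the operator in $\ell^2(\mathbb{Z}^2;\mathbb{C})$ $$L:(\omega_{\mathbf k})_{\mathbf k\in\mathbb{Z}^2}\mapsto\big(\alpha\beta(\mathbf p,\mathbf k-\mathbf p)\omega_{\mathbf k-\mathbf p}-\alpha\beta(\mathbf p,\mathbf k+\mathbf p)\omega_{\mathbf k+\mathbf p}\big)_{\mathbf k\in\mathbb{Z}^2}.$$ The flow is called (linearly) unstable if $L$ has nonimaginary spectrum. The operator $L_{\mathbf q}$ in $\ell^2(\mathbb{Z};\mathbb{C})$ is $$L_{\mathbf q}:(w_n)_{n\in\mathbb{Z}}\mapsto\big(\alpha\beta(\mathbf p,\mathbf q+(n-1)\mathbf p)w_{n-1}-\alpha\beta(\mathbf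 p,\mathbf q+(n+1)\mathbf p)w_{n+1}\big)_{n\in\mathbb{Z}}.$$ Put $\rho_n=1-\|\mathbf p\|^2\|\mathbf q+n\mathbf p\|^{-2}$, $n\in\mathbb{Z}$. Under the normalization of $\alpha$, $(L_{\mathbf q}w)_n=\rho_{n-1}w_{n-1}-\rho_{n+1}w_{n+1}$. Under the conditions on $\mathbf p,\mathbf q$ one has $\rho_{-1}=0$, $\rho_0<0$, $\rho_n\in(0,1)$ for $n\ne-1,0$, and $\rho_n=1+O(1/n^2)$ as $|n|\to\infty$. The five functions. Let $\mathbb{Z}_+=\{0,1,2,\dots\}$ and, for $n\ge0$, $b_n=-\lambda\sqrt{1-\rho_n}/\rho_n$, $c_n=\sqrt{1-\rho_n}$ (both sequences are in $\ell^2(\mathbb{Z}_+;\mathbb{C})$). Consider (E) $z_{n-1}-z_{n+1}+b_nc_nz_n=\lambda z_n$, $n\ge0$ (equivalently $z_{n-1}-z_{n+1}=\lambda z_n/\rho_n$), and (BC) $z_{-1}=0$. Let $S:(z_0,z_1,\dots)\mapsto(0,z_0,z_1,\dots)$ be the right shift and $S^{-1}:=S^*:(z_0,z_1,\dots)\mapsto(z_1,z_2,\dots)$ the left shift on $\ell^2(\mathbb{Z}_+;\mathbb{C})$; $S^{-1}$ also denotes the left shift on vector-valued sequences. The operator $S-S^{-1}-\lambda$ is invertible on $\ell^2(\mathbb{Z}_+;\mathbb{C})$ for $\lambda\notin[-2\mathrm{i},2\mathrm{i}]$. Matrices: $A=A(\lambda)=\begin{bmatrix}-\lambda&1\\1&0\end{bmatrix}$,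 $Q_+=\begin{bmatrix}1&0\\0&0\end{bmatrix}$, $B_n=b_nQ_+$, $C_n=c_nQ_+$, $A_n^\times=A+B_nC_n$. For $\lambda\notin[-2\mathrm{i},2\mathrm{i}]$ let $\mu_\pm=\mu_\pm(\lambda)$ be the roots of $\mu^2+\lambda\mu-1=0$ (the eigenvalues of $A$) with $|\mu_+|<1<|\mu_-|$. Let $P_+=P_+(\lambda)$ be the spectral projection of $A(\lambda)$ in $\mathbb{C}^2$ corresponding to $\mu_+$. Let $R_+=R_+(\lambda)$ be the projection in $\mathbb{C}^2$ onto $\operatorname{ran}P_+$ parallel to $\operatorname{ran}Q_+$, and $R_-=I_{2\times2}-R_+$. (1) $K_\lambda^+=-\operatorname{diag}_{n\in\mathbb{Z}_+}\{c_n\}\,(S-S^{-1}-\lambda)^{-1}\operatorname{diag}_{n\in\mathbb{Z}_+}\{b_n\}$, a trace class operator on $\ell^2(\mathbb{Z}_+;\mathbb{C})$; $\det(I-K^+_\lambda)$ is the Fredholm determinant. (2) Let $\ell^2_{\operatorname{ran}Q_+}(\mathbb{Z}_+;\mathbb{C}^2)=\{(y_n)_{n\ge0}\in\ell^2(\mathbb{Z}_+;\mathbb{C}^2):y_0\in\operatorname{ran}Q_+\}$. For $\lambda\notin[-2\mathrm{i},2\mathrm{i}]$ the operator $S^{-1}-\operatorname{diag}_{n\in\mathbb{Z}_+}\{A\}$ is invertible from $\ell^2_{\operatorname{ran}Q_+}(\mathbb{Z}_+;\mathbb{C}^2)$ onto $\ell^2(\mathbb{Z}_+;\mathbb{C}^2)$;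 with this inverse define $\mathcal{T}_\lambda^+=\operatorname{diag}_{n\in\mathbb{Z}_+}\{C_n\}\big(S^{-1}-\operatorname{diag}_{n\in\mathbb{Z}_+}\{A\}\big)^{-1}\operatorname{diag}_{n\in\mathbb{Z}_+}\{B_n\}$, a trace class operator on $\ell^2(\mathbb{Z}_+;\mathbb{C}^2)$; $\det(I-\mathcal{T}^+_\lambda)$ is the Fredholm determinant. (3) The matrix-valued Jost solution $(Y_n^+)_{n\ge0}$, $Y_n^+=Y_n^+(\lambda)\in\mathbb{C}^{2\times2}$, is the unique solution of $Y_{n+1}=A_n^\times Y_n$, $n\ge0$, such that $\|(\mu_+)^{-n}(Y_n^+-A^nR_+)\|\to0$ as $n\to+\infty$ and $Y_0^+=Y_0^+R_+$. The Evans function is $\mathcal{E}^+(\lambda)=\det\big(Y_0^+(\lambda)+R_-(\lambda)\big)$. (4) The Jost solution $\mathbf{z}^+=(z_n^+)_{n\ge-1}$ is the unique solution of (E) (without (BC)) such that $(\mu_+)^{-n}z_n^+\to1$ as $n\to+\infty$. The regular solution $\mathbf{z}^{\mathrm r}=(z_n^{\mathrm r})_{n\ge-1}$ is the solution of (E) with $z_{-1}^{\mathrm r}=0$, $z_0^{\mathrm r}=1$. For sequences $\mathbf u=(u_n)_{n\ge-1}$, $\mathbf v=(v_n)_{n\ge-1}$ put $\mathcal{W}(\mathbf u,\mathbf v)_n=(-1)^{n}(u_{n-1}v_n-u_nv_{n-1})$, $n\ge0$; thus $\mathcal{W}(\mathbf z^+,\mathbf z^{\mathrm r})_0=z_{-1}^+(\lambda)$.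 The Jost function is $\mathcal{F}^+(\lambda)=\mu_+(\lambda)\,\mathcal{W}(\mathbf z^+(\lambda),\mathbf z^{\mathrm r}(\lambda))_0=\mu_+(\lambda)z^+_{-1}(\lambda)$. (5) For $\operatorname{Re}(\lambda)>0$ let $g_+(\lambda)$ be the (convergent) continued fraction $$g_+(\lambda)=\cfrac{1}{\frac{\lambda}{\rho_1}+\cfrac{1}{\frac{\lambda}{\rho_2}+\cdots}},$$ and put $\mathcal{G}^+(\lambda)=\mu_+(\lambda)\,z_0^+(\lambda)\,\big(g_+(\lambda)+\lambda/\rho_0\big)$, where $z_0^+(\lambda)$ is the $0$-th entry of the Jost solution. *)

theory Defs
  imports "HOL-Analysis.Analysis"
begin

definition ell2 :: "('i \<Rightarrow> 'a::real_normed_vector) set" where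
  "ell2 = {w. (\<lambda>i. (norm (w i))\<^sup>2) summable_on UNIV}"

definition ell2_norm :: "('i \<Rightarrow> 'a::real_normed_vector) \<Rightarrow> real" where
  "ell2_norm w = sqrt (\<Sum>\<^sub>\<infinity>i. (norm (w i))\<^sup>2)"

text \<open>A linear map \<open>T\<close> on all families acts as an operator in \<open>ell2\<close> with its maximal domain.
  For a bounded operator this domain is the whole of \<open>ell2\<close>.\<close>

definition op_domain :: "(('i \<Rightarrow> complex) \<Rightarrow> 'i \<Rightarrow> complex) \<Rightarrow> ('i \<Rightarrow> complex) set" where
  "op_domain T = {w \<in> ell2. T w \<in> ell2}"

definition is_eigenvalue :: "(('i \<Rightarrow> complex) \<Rightarrow> 'i \<Rightarrow> complex) \<Rightarrow> complex \<Rightarrow> bool" where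
  "is_eigenvalue T l \<longleftrightarrow> (\<exists>w \<in> op_domain T. w \<noteq> (\<lambda>_. 0) \<and> T w = (\<lambda>i. l * w i))"

definition resolvent_set :: "(('i \<Rightarrow> complex) \<Rightarrow> 'i \<Rightarrow> complex) \<Rightarrow> complex set" where
  "resolvent_set T =
     {l. bij_betw (\<lambda>w i. T w i - l * w i) (op_domain T) ell2 \<and>
         (\<exists>C. \<forall>w \<in> op_domain T. ell2_norm w \<le> C * ell2_norm (\<lambda>i. T w i - l * w i))}"

definition op_spectrum :: "(('i \<Rightarrow> complex) \<Rightarrow> 'i \<Rightarrow> complex) \<Rightarrow> complex set" where
  "op_spectrum T = - resolvent_set T"

text \<open>Fredholm determinants: for a trace class operator \<open>a\<close>, given by its matrix entries in an
  orthonormal basis \<open>(e\<^sub>i)\<close>, the determinant of \<open>I + a\<close> is the sum over \<open>k\<close> of the traces of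
  the exterior powers \<open>\<Lambda>\<^sup>k a\<close>.  In the orthonormal basis of the vectors
  \<open>e\<^bsub>i1\<^esub> \<and> \<dots> \<and> e\<^bsub>ik\<^esub>\<close> (one for each \<open>k\<close>-element index set) the diagonal entries of \<open>\<Lambda>\<^sup>k a\<close>
  are the principal minors of \<open>a\<close> of size \<open>k\<close>.\<close>

definition principal_minor :: "('b \<Rightarrow> 'b \<Rightarrow> complex) \<Rightarrow> 'b set \<Rightarrow> complex" where
  "principal_minor a F = (\<Sum>\<pi> | \<pi> permutes F. of_int (sign \<pi>) * (\<Prod>i\<in>F. a i (\<pi> i)))"

definition ext_power_trace :: "('b \<Rightarrow> 'b \<Rightarrow> complex) \<Rightarrow> nat \<Rightarrow> complex" where
  "ext_power_trace a k = (\<Sum>\<^sub>\<infinity>F \<in> {F. finite F \<and> card F = k}. principal_minor a F)"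

definition fredholm_det_I_plus :: "('b \<Rightarrow> 'b \<Rightarrow> complex) \<Rightarrow> complex" where
  "fredholm_det_I_plus a = (\<Sum>k. ext_power_trace a k)"

definition proj_onto_parallel :: "(complex^2) set \<Rightarrow> (complex^2) set \<Rightarrow> complex^2^2" where
  "proj_onto_parallel X Y =
     (THE P. P ** P = P \<and> range ((*v) P) = X \<and> {v. P *v v = 0} = Y)"

text \<open>The spectral projection at an eigenvalue \<open>m\<close> is the projection onto the generalized
  eigenspace parallel to the complementary invariant subspace, i.e. parallel to the sum of the
  other generalized eigenspaces (second powers suffice in dimension two).\<close>

definition spectral_proj :: "complex^2^2 \<Rightarrow> complex \<Rightarrow> complex^2^2" where
  "spectral_proj M m =
     (let N = (M - mat m) ** (M - mat m)
      in proj_onto_parallel {v. N *v v = 0} (range ((*v) N)))"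

definition matrix_power :: "complex^2^2 \<Rightarrow> nat \<Rightarrow> complex^2^2" where
  "matrix_power M n = (((**) M) ^^ n) (mat 1)"

type_synonym zvec = "int \<times> int"

definition znorm :: "zvec \<Rightarrow> real" where
  "znorm k = norm (real_of_int (fst k), real_of_int (snd k))"

definition zscale :: "int \<Rightarrow> zvec \<Rightarrow> zvec" where
  "zscale n k = (n * fst k, n * snd k)"

definition wedge :: "zvec \<Rightarrow> zvec \<Rightarrow> int" where
  "wedge p q = fst p * snd q - snd p * fst q"

definition beta :: "zvec \<Rightarrow> zvec \<Rightarrow> real" where
  "beta p q = (if p \<noteq> 0 \<and> q \<noteq> 0
     then 1 / 2 * (1 / (znorm q)\<^sup>2 - 1 / (znorm p)\<^sup>2) * real_of_int (wedge p q) else 0)"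

definition L_op :: "real \<Rightarrow> zvec \<Rightarrow> (zvec \<Rightarrow> complex) \<Rightarrow> zvec \<Rightarrow> complex" where
  "L_op \<alpha> p w = (\<lambda>k. of_real (\<alpha> * beta p (k - p)) * w (k - p)
                   - of_real (\<alpha> * beta p (k + p)) * w (k + p))"

definition Lq_op :: "real \<Rightarrow> zvec \<Rightarrow> zvec \<Rightarrow> (int \<Rightarrow> complex) \<Rightarrow> int \<Rightarrow> complex" where
  "Lq_op \<alpha> p q w =
     (\<lambda>n. of_real (\<alpha> * beta p (q + zscale (n - 1) p)) * w (n - 1)
        - of_real (\<alpha> * beta p (q + zscale (n + 1) p)) * w (n + 1))"

text \<open>Linear instability of the steady state with vorticity \<open>\<alpha> cos (p \<bullet> x)\<close> on the torus;
  \<open>L_op \<alpha> p\<close> is the linearized Euler operator at this state in Fourier variables.\<close>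

definition linearly_unstable :: "real \<Rightarrow> zvec \<Rightarrow> bool" where
  "linearly_unstable \<alpha> p \<longleftrightarrow> (\<exists>l \<in> op_spectrum (L_op \<alpha> p). Re l \<noteq> 0)"

definition rho :: "zvec \<Rightarrow> zvec \<Rightarrow> int \<Rightarrow> real" where
  "rho p q n = 1 - (znorm p)\<^sup>2 / (znorm (q + zscale n p))\<^sup>2"

text \<open>Below \<open>r\<close> stands for the sequence \<open>\<rho>\<close> and \<open>l\<close> for the spectral parameter \<open>\<lambda>\<close>.\<close>

definition b_seq :: "(int \<Rightarrow> real) \<Rightarrow> complex \<Rightarrow> nat \<Rightarrow> complex" where
  "b_seq r l n = - l * of_real (sqrt (1 - r (int n))) / of_real (r (int n))"

definition c_seq :: "(int \<Rightarrow> real) \<Rightarrow> nat \<Rightarrow> complex" where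
  "c_seq r n = of_real (sqrt (1 - r (int n)))"

definition mu_plus :: "complex \<Rightarrow> complex" where
  "mu_plus l = (THE m. m\<^sup>2 + l * m - 1 = 0 \<and> cmod m < 1)"

definition shift_right :: "(nat \<Rightarrow> complex) \<Rightarrow> nat \<Rightarrow> complex" where
  "shift_right z = (\<lambda>n. case n of 0 \<Rightarrow> 0 | Suc m \<Rightarrow> z m)"

definition shift_left :: "(nat \<Rightarrow> 'a) \<Rightarrow> nat \<Rightarrow> 'a" where
  "shift_left z = (\<lambda>n. z (Suc n))"

definition K_plus :: "(int \<Rightarrow> real) \<Rightarrow> complex \<Rightarrow> (nat \<Rightarrow> complex) \<Rightarrow> nat \<Rightarrow> complex" where
  "K_plus r l z = (\<lambda>n. - (c_seq r n *
     the_inv_into ell2 (\<lambda>x k. shift_right x k - shift_left x k - l * x k)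
       (\<lambda>k. b_seq r l k * z k) n))"

definition det_K_plus :: "(int \<Rightarrow> real) \<Rightarrow> complex \<Rightarrow> complex" where
  "det_K_plus r l =
     fredholm_det_I_plus (\<lambda>i j. - K_plus r l (\<lambda>k. if k = j then 1 else 0) i)"

definition A_mat :: "complex \<Rightarrow> complex^2^2" where
  "A_mat l = vector [vector [- l, 1], vector [1, 0]]"

definition Q_plus :: "complex^2^2" where
  "Q_plus = vector [vector [1, 0], vector [0, 0]]"

definition B_mat :: "(int \<Rightarrow> real) \<Rightarrow> complex \<Rightarrow> nat \<Rightarrow> complex^2^2" where
  "B_mat r l n = mat (b_seq r l n) ** Q_plus"

definition C_mat :: "(int \<Rightarrow> real) \<Rightarrow> nat \<Rightarrow> complex^2^2" where
  "C_mat r n = mat (c_seq r n) ** Q_plus"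

definition A_cross :: "(int \<Rightarrow> real) \<Rightarrow> complex \<Rightarrow> nat \<Rightarrow> complex^2^2" where
  "A_cross r l n = A_mat l + B_mat r l n ** C_mat r n"

definition ell2_ranQ :: "(nat \<Rightarrow> complex^2) set" where
  "ell2_ranQ = {y \<in> ell2. y 0 \<in> range ((*v) Q_plus)}"

definition T_plus :: "(int \<Rightarrow> real) \<Rightarrow> complex \<Rightarrow> (nat \<Rightarrow> complex^2) \<Rightarrow> nat \<Rightarrow> complex^2" where
  "T_plus r l y = (\<lambda>n. C_mat r n *v
     the_inv_into ell2_ranQ (\<lambda>x k. shift_left x k - A_mat l *v x k)
       (\<lambda>k. B_mat r l k *v y k) n)"

text \<open>The standard orthonormal basis of the space of square-summable sequences in the complex
  plane \<open>complex^2\<close> is indexed by pairs (position in the sequence, coordinate).\<close>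

definition det_T_plus :: "(int \<Rightarrow> real) \<Rightarrow> complex \<Rightarrow> complex" where
  "det_T_plus r l = fredholm_det_I_plus (\<lambda>(i :: nat \<times> 2) (j :: nat \<times> 2).
     - (T_plus r l (\<lambda>k. if k = fst j then axis (snd j) 1 else 0) (fst i) $ snd i))"

definition P_plus :: "complex \<Rightarrow> complex^2^2" where
  "P_plus l = spectral_proj (A_mat l) (mu_plus l)"

definition R_plus :: "complex \<Rightarrow> complex^2^2" where
  "R_plus l = proj_onto_parallel (range ((*v) (P_plus l))) (range ((*v) Q_plus))"

definition R_minus :: "complex \<Rightarrow> complex^2^2" where
  "R_minus l = mat 1 - R_plus l"

definition jost_matrix :: "(int \<Rightarrow> real) \<Rightarrow> complex \<Rightarrow> nat \<Rightarrow> complex^2^2" where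
  "jost_matrix r l = (THE Y.
     (\<forall>n. Y (Suc n) = A_cross r l n ** Y n) \<and>
     (\<lambda>n. norm (mat (mu_plus l powi (- int n)) **
                 (Y n - matrix_power (A_mat l) n ** R_plus l))) \<longlonglongrightarrow> 0 \<and>
     Y 0 = Y 0 ** R_plus l)"

definition evans_plus :: "(int \<Rightarrow> real) \<Rightarrow> complex \<Rightarrow> complex" where
  "evans_plus r l = det (jost_matrix r l 0 + R_minus l)"

text \<open>Sequences indexed by \<open>n \<ge> -1\<close> are functions on \<open>int\<close> that are \<open>extensional\<close> on \<open>{-1..}\<close>,
  so that such a sequence is determined by its entries.\<close>

definition solves_E :: "(int \<Rightarrow> real) \<Rightarrow> complex \<Rightarrow> (int \<Rightarrow> complex) \<Rightarrow> bool" where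
  "solves_E r l z \<longleftrightarrow> z \<in> extensional {-1..} \<and>
     (\<forall>n::nat. z (int n - 1) - z (int n + 1) + b_seq r l n * c_seq r n * z (int n)
               = l * z (int n))"

definition jost_solution :: "(int \<Rightarrow> real) \<Rightarrow> complex \<Rightarrow> int \<Rightarrow> complex" where
  "jost_solution r l = (THE z. solves_E r l z \<and>
     (\<lambda>n::nat. mu_plus l powi (- int n) * z (int n)) \<longlonglongrightarrow> 1)"

definition regular_solution :: "(int \<Rightarrow> real) \<Rightarrow> complex \<Rightarrow> int \<Rightarrow> complex" where
  "regular_solution r l = (THE z. solves_E r l z \<and> z (-1) = 0 \<and> z 0 = 1)"

definition wronskian :: "(int \<Rightarrow> complex) \<Rightarrow> (int \<Rightarrow> complex) \<Rightarrow> nat \<Rightarrow> complex" where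
  "wronskian u v n = (-1) ^ n * (u (int n - 1) * v (int n) - u (int n) * v (int n - 1))"

definition jost_function :: "(int \<Rightarrow> real) \<Rightarrow> complex \<Rightarrow> complex" where
  "jost_function r l = mu_plus l * wronskian (jost_solution r l) (regular_solution r l) 0"

text \<open>\<open>cf_approx a m N\<close> is the finite continued fraction
  \<open>1 / (a\<^sub>m + 1 / (a\<^bsub>m+1\<^esub> + \<dots> + 1 / a\<^bsub>m+N-1\<^esub>))\<close>.\<close>

fun cf_approx :: "(nat \<Rightarrow> complex) \<Rightarrow> nat \<Rightarrow> nat \<Rightarrow> complex" where
  "cf_approx a m 0 = 0"
| "cf_approx a m (Suc N) = 1 / (a m + cf_approx a (Suc m) N)"

definition g_plus :: "(int \<Rightarrow> real) \<Rightarrow> complex \<Rightarrow> complex" where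
  "g_plus r l = lim (\<lambda>N. cf_approx (\<lambda>k. l / of_real (r (int k))) 1 N)"

definition G_plus :: "(int \<Rightarrow> real) \<Rightarrow> complex \<Rightarrow> complex" where
  "G_plus r l = mu_plus l * jost_solution r l 0 * (g_plus r l + l / of_real (r 0))"

end

theory Submission
  imports Defs
begin

text \<open>
  All five functions have the same value.  Put \<open>X\<^sub>k = z\<^bsub>k-1\<^esub>\<close>.  Equation (E) becomes the
  three-term recurrence \<open>X\<^sub>k - X\<^bsub>k+2\<^esub> = (\<lambda> / \<rho>\<^sub>k) X\<^bsub>k+1\<^esub>\<close>, a summable perturbation of the
  recurrence with the constant coefficient \<open>\<lambda> = 1 / \<mu> - \<mu>\<close>, where \<open>\<mu> = \<mu>\<^sub>+\<close>.  It has exactly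
  one solution \<open>J\<close> with \<open>J\<^sub>k / \<mu>\<^sup>k \<longlonglongrightarrow> 1\<close> (\<open>jost_exists\<close>, \<open>jost_unique\<close>), and \<open>J = \<mu> z\<^sup>+\<close> up to
  the shift.  The common value is \<open>J\<^sub>0\<close>.

  \<^item> The Wronskian with the regular solution at the left end is \<open>J\<^sub>0 / \<mu>\<close>.

  \<^item> The projection \<open>R\<^sub>+\<close> maps \<open>v\<close> to \<open>v\<^sub>2 (\<mu>, 1)\<close>, so the first column of the Jost matrix vanishes
  and the second is \<open>(J\<^bsub>n+1\<^esub>, J\<^sub>n)\<close>; adding \<open>R\<^sub>-\<close> leaves a triangular matrix with diagonal
  \<open>1, J\<^sub>0\<close>.

  \<^item> By Pincherle's theorem the continued fraction converges to \<open>J\<^sub>2 / J\<^sub>1\<close> (\<open>cf_converges\<close>), and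
  \<open>J\<^sub>1 (J\<^sub>2 / J\<^sub>1 + \<lambda> / \<rho>\<^sub>0) = J\<^sub>0\<close> is the recurrence.

  \<^item> The entries of \<open>K\<^sub>\<lambda>\<^sup>+\<close> are built from the Green function of \<open>S - S\<^sup>* - \<lambda>\<close>, which up to a
  sign is a product of a function of \<open>min i j\<close> and a function of \<open>max i j\<close>.  For such a kernel
  one row operation removes the largest index from a principal minor.  Hence the sums over all
  subsets of \<open>{0..<N}\<close> satisfy a linear recursion, which the regular solution \<open>X\<close> solves
  explicitly; they equal \<open>(-\<mu>)\<^sup>N (X\<^bsub>N+1\<^esub> - \<mu> X\<^sub>N)\<close>.  Since \<open>J\<^sub>N\<close> is asymptotic to \<open>\<mu>\<^sup>N\<close>, this
  has the same limit as the (constant) Casoratian of \<open>J\<close> and \<open>X\<close>, and that constant is \<open>J\<^sub>0\<close>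
  (\<open>fredholm_det_semiseparable\<close>).  The operator \<open>\<T>\<^sub>\<lambda>\<^sup>+\<close> has the same matrix, padded by zeros.

  An eigenvector \<open>w\<close> of \<open>L\<^sub>q\<close> gives the solution \<open>\<rho>\<^sub>n w\<^sub>n\<close> of the recurrence, and \<open>\<rho>\<^bsub>-1\<^esub> = 0\<close>
  decouples the two half lines.  On the left one all \<open>\<rho>\<^sub>n\<close> are positive, and an energy identity
  excludes nonzero decaying solutions when \<open>Re \<lambda> > 0\<close>.  On the right one a decaying solution is a
  multiple of \<open>J\<close>, so the boundary condition at \<open>-1\<close> says \<open>J\<^sub>0 = 0\<close> (\<open>eigenvalue_iff\<close>).

  For real \<open>\<lambda> = x > 0\<close> a zero is a solution of \<open>g\<^sub>+(x) = x / \<bar>\<rho>\<^sub>0\<bar>\<close>.  The approximants of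
  \<open>g\<^sub>+\<close> are continuous and bracket it from both sides, so the sets where \<open>g\<^sub>+(x)\<close> is larger or
  smaller than \<open>x / \<bar>\<rho>\<^sub>0\<bar>\<close> are open.  Both are nonempty: \<open>g\<^sub>+(x) \<le> 1 / x\<close> for large \<open>x\<close>, and
  \<open>g\<^sub>+(x) / x\<close> is unbounded near \<open>0\<close>.  As the half line is connected, equality occurs
  (\<open>exists_positive_jost_zero\<close>).  Extending the eigenvector by zero off the line \<open>q + \<int> p\<close> gives
  an eigenvector of \<open>L\<close>.
\<close>

section \<open>Three-term recurrences and their decaying solutions\<close>

text \<open>Indices are shifted by one against (E): \<open>X\<^sub>n\<close> stands for
  \<open>z\<^bsub>n-1\<^esub>\<close>, so that solutions are functions on the natural numbers
  and the boundary condition reads \<open>X\<^sub>0 = 0\<close>.\<close>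

definition three_term :: "(nat \<Rightarrow> complex) \<Rightarrow> (nat \<Rightarrow> complex) \<Rightarrow> bool" where
  "three_term a X \<longleftrightarrow> (\<forall>n. X n - X (Suc (Suc n)) = a n * X (Suc n))"

fun initial_solution :: "(nat \<Rightarrow> complex) \<Rightarrow> complex \<Rightarrow> complex \<Rightarrow> nat \<Rightarrow> complex" where
  "initial_solution a x y 0 = x"
| "initial_solution a x y (Suc 0) = y"
| "initial_solution a x y (Suc (Suc n)) =
     initial_solution a x y n - a n * initial_solution a x y (Suc n)"

lemma three_termD: "three_term a X \<Longrightarrow> X n - X (Suc (Suc n)) = a n * X (Suc n)"
  by (simp add: three_term_def)

lemma three_term_Suc_Suc: "three_term a X \<Longrightarrow> X (Suc (Suc n)) = X n - a n * X (Suc n)"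
  using three_termD[of a X n] by (simp add: algebra_simps)

lemma three_term_initial_solution: "three_term a (initial_solution a x y)"
  by (simp add: three_term_def)

lemma three_term_cmult: "three_term a X \<Longrightarrow> three_term a (\<lambda>n. c * X n)"
  unfolding three_term_def by (simp only: right_diff_distrib [symmetric] mult.left_commute simp_thms)

lemma three_term_diff:
  assumes "three_term a X" "three_term a Y"
  shows "three_term a (\<lambda>n. X n - Y n)"
  unfolding three_term_def
proof
  fix n
  show "X n - Y n - (X (Suc (Suc n)) - Y (Suc (Suc n))) = a n * (X (Suc n) - Y (Suc n))"
    using three_termD[OF assms(1), of n] three_termD[OF assms(2), of n]
    by (simp only: right_diff_distrib) (simp add: algebra_simps)
qed

lemma three_term_eq_0:
  assumes "three_term a X" "X 0 = 0" "X (Suc 0) = 0"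
  shows "X n = 0"
proof -
  have "X n = 0 \<and> X (Suc n) = 0"
    by (induction n) (simp_all add: assms(2,3) three_term_Suc_Suc[OF assms(1)])
  then show ?thesis by simp
qed

lemma three_term_unique:
  assumes "three_term a X" "three_term a Y" "X 0 = Y 0" "X (Suc 0) = Y (Suc 0)"
  shows "X = Y"
proof
  fix n
  have "X n - Y n = 0"
    by (rule three_term_eq_0[OF three_term_diff[OF assms(1,2)]]) (use assms(3,4) in auto)
  then show "X n = Y n" by simp
qed

text \<open>The sign \<open>(-1)\<^sup>n\<close> compensates that the transfer matrix of the
  recurrence has determinant \<open>-1\<close>.\<close>

lemma casoratian_const:
  assumes "three_term a X" "three_term a Y"
  shows "(-1) ^ n * (X n * Y (Suc n) - X (Suc n) * Y n) = X 0 * Y (Suc 0) - X (Suc 0) * Y 0"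
proof (induction n)
  case (Suc n)
  have "(-1) ^ Suc n * (X (Suc n) * Y (Suc (Suc n)) - X (Suc (Suc n)) * Y (Suc n)) =
    (-1) ^ n * (X n * Y (Suc n) - X (Suc n) * Y n)"
    unfolding three_term_Suc_Suc[OF assms(1), of n] three_term_Suc_Suc[OF assms(2), of n]
    by (simp add: algebra_simps)
  then show ?case by (rule trans[OF _ Suc.IH])
qed simp

text \<open>The Casoratian is constant and tends to zero, so it vanishes at the left end as
  well.\<close>

lemma decaying_solutions_proportional:
  assumes "three_term a X" "three_term a Y" "X \<longlonglongrightarrow> 0" "Y \<longlonglongrightarrow> 0"
  shows "X 0 * Y (Suc 0) = X (Suc 0) * Y 0"
proof -
  have "(\<lambda>n. X n * Y (Suc n) - X (Suc n) * Y n) \<longlonglongrightarrow> 0 * 0 - 0 * 0"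
    by (intro tendsto_intros LIMSEQ_Suc assms)
  then have "(\<lambda>n. (-1) ^ n * (X n * Y (Suc n) - X (Suc n) * Y n)) \<longlonglongrightarrow> 0"
    by (intro tendsto_norm_zero_cancel[of "\<lambda>n. (-1) ^ n * (X n * Y (Suc n) - X (Suc n) * Y n)"])
      (simp add: norm_mult norm_power tendsto_norm_zero)
  then show ?thesis
    unfolding casoratian_const[OF assms(1,2)] by (simp add: LIMSEQ_const_iff)
qed

text \<open>Writing \<open>X\<^sub>k = m\<^sup>k V\<^sub>k\<close> and \<open>d\<^sub>k =
  V\<^sub>k - V\<^bsub>k+1\<^esub>\<close>, the recurrence with coefficient \<open>1 / m - m +
  e\<^sub>k\<close> becomes \<open>d\<^sub>k = - m\<^sup>2 d\<^bsub>k+1\<^esub> + m e\<^sub>k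
  V\<^bsub>k+1\<^esub>\<close>. The pair below is \<open>(V\<^sub>k, d\<^sub>k)\<close> for the
  solution that starts with \<open>(1, 0)\<close> at \<open>k + j\<close> and is continued
  downwards in \<open>j\<close> steps.\<close>

fun jost_approx :: "complex \<Rightarrow> (nat \<Rightarrow> complex) \<Rightarrow> nat \<Rightarrow> nat \<Rightarrow> complex \<times> complex" where
  "jost_approx m e 0 k = (1, 0)"
| "jost_approx m e (Suc j) k =
     (let (V, d) = jost_approx m e j (Suc k); d' = - m\<^sup>2 * d + m * e k * V in (V + d', d'))"

text \<open>Starting one step later changes the starting pair only by
  \<open>O(\<bar>e\<^bsub>k+j\<^esub>\<bar>)\<close>. In the norm \<open>\<bar>V\<bar> + K
  \<bar>d\<bar>\<close> with \<open>(1 + K) \<bar>m\<bar>\<^sup>2 = K\<close> a downward step is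
  bounded by \<open>1 + (1 + K) \<bar>e\<^sub>k\<bar>\<close>, and the product of these bounds
  converges.\<close>

lemma jost_approx_increment:
  fixes m :: complex and e :: "nat \<Rightarrow> complex"
  assumes m: "norm m < 1" and sm: "summable (\<lambda>n. norm (e n))"
  obtains B where "B \<ge> 0"
    "\<And>j k. norm (fst (jost_approx m e (Suc j) k) - fst (jost_approx m e j k)) \<le> B * norm (e (k + j))"
proof -
  define K where "K = (norm m)\<^sup>2 / (1 - (norm m)\<^sup>2)"
  have m2: "(norm m)\<^sup>2 < 1" using m by (simp add: power_less_one_iff)
  have K0: "K \<ge> 0" using m2 by (simp add: K_def)
  have K1: "(1 + K) * (norm m)\<^sup>2 = K" using m2 by (simp add: K_def field_simps)
  define N where "N = (\<lambda>x::complex \<times> complex. norm (fst x) + K * norm (snd x))"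
  define D where "D = (\<lambda>j k. jost_approx m e (Suc j) k - jost_approx m e j k)"
  have step: "N (V + (- m\<^sup>2 * d + m * c * V), - m\<^sup>2 * d + m * c * V) \<le> (1 + (1 + K) * norm c) * N (V, d)"
    for V d c
  proof -
    have "norm (- m\<^sup>2 * d + m * c * V) \<le> norm (m\<^sup>2 * d) + norm (m * c * V)"
      using norm_triangle_ineq[of "- m\<^sup>2 * d" "m * c * V"] by simp
    then have d: "norm (- m\<^sup>2 * d + m * c * V) \<le> (norm m)\<^sup>2 * norm d + norm m * (norm c * norm V)"
      by (simp add: norm_mult norm_power)
    have "norm m * (norm c * norm V) \<le> norm c * norm V"
      using m by (simp add: mult_left_le_one_le)
    with d have d: "norm (- m\<^sup>2 * d + m * c * V) \<le> (norm m)\<^sup>2 * norm d + norm c * norm V" by linarith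
    have "N (V + (- m\<^sup>2 * d + m * c * V), - m\<^sup>2 * d + m * c * V) \<le>
      norm V + (1 + K) * norm (- m\<^sup>2 * d + m * c * V)"
      using norm_triangle_ineq[of V "- m\<^sup>2 * d + m * c * V"] by (simp add: N_def algebra_simps)
    also have "\<dots> \<le> norm V + (1 + K) * ((norm m)\<^sup>2 * norm d + norm c * norm V)"
      using mult_left_mono[OF d, of "1 + K"] K0 by simp
    also have "\<dots> = norm V + ((1 + K) * (norm m)\<^sup>2) * norm d + (1 + K) * norm c * norm V"
      by (simp add: algebra_simps)
    also have "\<dots> = norm V + K * norm d + (1 + K) * norm c * norm V"
      by (simp only: K1)
    also have "\<dots> \<le> (1 + (1 + K) * norm c) * N (V, d)"
      using K0 by (simp add: N_def algebra_simps)
    finally show ?thesis .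
  qed
  have bound: "N (D j k) \<le> (1 + K) * norm (e (k + j)) * (\<Prod>i<j. 1 + (1 + K) * norm (e (k + i)))" for j k
  proof (induction j arbitrary: k)
    case 0
    have "norm m * norm (e k) \<le> norm (e k)" using m by (simp add: mult_left_le_one_le)
    then have "(1 + K) * (norm m * norm (e k)) \<le> (1 + K) * norm (e k)"
      using K0 by (intro mult_left_mono) auto
    then show ?case by (simp add: D_def N_def norm_mult algebra_simps)
  next
    case (Suc j)
    define V d where "V = fst (D j (Suc k))" and "d = snd (D j (Suc k))"
    have "D (Suc j) k = (V + (- m\<^sup>2 * d + m * e k * V), - m\<^sup>2 * d + m * e k * V)"
      unfolding D_def V_def d_def
      by (simp add: Let_def case_prod_unfold algebra_simps prod_eq_iff)
    then have "N (D (Suc j) k) \<le> (1 + (1 + K) * norm (e k)) * N (D j (Suc k))"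
      using step[of V d "e k"] by (simp add: V_def d_def)
    also have "\<dots> \<le> (1 + (1 + K) * norm (e k)) *
      ((1 + K) * norm (e (Suc k + j)) * (\<Prod>i<j. 1 + (1 + K) * norm (e (Suc k + i))))"
      using K0 by (intro mult_left_mono Suc) auto
    also have "\<dots> = (1 + K) * norm (e (k + Suc j)) * (\<Prod>i<Suc j. 1 + (1 + K) * norm (e (k + i)))"
      unfolding prod.lessThan_Suc_shift by (simp add: algebra_simps)
    finally show ?case .
  qed
  define T where "T = (\<Sum>n. norm (e n))"
  define B where "B = (1 + K) * exp ((1 + K) * T)"
  show ?thesis
  proof
    show "B \<ge> 0" using K0 by (simp add: B_def)
    fix j k
    have "(\<Prod>i<j. 1 + (1 + K) * norm (e (k + i))) \<le> (\<Prod>i<j. exp ((1 + K) * norm (e (k + i))))"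
      using K0 by (intro prod_mono) (auto intro: exp_ge_add_one_self)
    also have "\<dots> = exp ((1 + K) * (\<Sum>i<j. norm (e (k + i))))"
      by (simp add: exp_sum sum_distrib_left)
    also have "(\<Sum>i<j. norm (e (k + i))) = (\<Sum>i\<in>{k..<k+j}. norm (e i))"
      by (rule sum.reindex_bij_witness[of _ "\<lambda>i. i - k" "\<lambda>i. k + i"]) auto
    also have "exp ((1 + K) * \<dots>) \<le> exp ((1 + K) * T)"
      using K0 by (simp add: T_def, intro mult_left_mono sum_le_suminf sm) auto
    finally have P: "(\<Prod>i<j. 1 + (1 + K) * norm (e (k + i))) \<le> exp ((1 + K) * T)" .
    have "norm (fst (D j k)) \<le> N (D j k)" using K0 by (simp add: N_def)
    also have "\<dots> \<le> (1 + K) * norm (e (k + j)) * exp ((1 + K) * T)"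
      using bound[of j k] P K0 by (meson mult_left_mono mult_nonneg_nonneg norm_ge_zero order_trans add_nonneg_nonneg zero_le_one)
    finally show "norm (fst (jost_approx m e (Suc j) k) - fst (jost_approx m e j k)) \<le> B * norm (e (k + j))"
      by (simp add: D_def B_def mult_ac del: jost_approx.simps)
  qed
qed

text \<open>The approximants from \<open>k + j\<close> are Cauchy in \<open>j\<close>, and their
  limit differs from \<open>1\<close> by at most a multiple of the tail
  \<open>\<Sum>\<^bsub>i\<ge>k\<^esub> \<bar>e\<^sub>i\<bar>\<close>.\<close>

lemma jost_exists:
  fixes m :: complex and e :: "nat \<Rightarrow> complex"
  assumes m: "norm m < 1" "m \<noteq> 0" and sm: "summable (\<lambda>n. norm (e n))"
  shows "\<exists>X. three_term (\<lambda>n. 1 / m - m + e n) X \<and> (\<lambda>n. X n / m ^ n) \<longlonglongrightarrow> 1"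
proof -
  obtain B where B: "B \<ge> 0"
    "\<And>j k. norm (fst (jost_approx m e (Suc j) k) - fst (jost_approx m e j k)) \<le> B * norm (e (k + j))"
    using jost_approx_increment[OF m(1) sm] by blast
  define v where "v = (\<lambda>j k. fst (jost_approx m e j k))"
  have vB: "norm (v (Suc j) k - v j k) \<le> B * norm (e (k + j))" for j k
    using B(2) unfolding v_def .
  have v0: "v 0 k = 1" for k by (simp add: v_def)
  have rec: "v (Suc (Suc j)) k = v (Suc j) (Suc k) - m\<^sup>2 * (v (Suc j) (Suc k) - v j (Suc (Suc k)))
     + m * e k * v (Suc j) (Suc k)" for j k
    by (simp add: v_def Let_def case_prod_unfold algebra_simps)
  have sk: "summable (\<lambda>j. B * norm (e (k + j)))" for k
    using summable_ignore_initial_segment[OF sm, of k]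
    by (intro summable_mult) (simp add: add.commute)
  have sd: "summable (\<lambda>j. norm (v (Suc j) k - v j k))" for k
    by (rule summable_comparison_test'[OF sk[of k], of 0]) (use vB in auto)
  define V where "V = (\<lambda>k. 1 + (\<Sum>j. v (Suc j) k - v j k))"
  have lim: "(\<lambda>j. v j k) \<longlonglongrightarrow> V k" for k
  proof -
    have "(\<lambda>n. \<Sum>j<n. v (Suc j) k - v j k) \<longlonglongrightarrow> (\<Sum>j. v (Suc j) k - v j k)"
      by (rule summable_LIMSEQ[OF summable_norm_cancel[OF sd]])
    then have "(\<lambda>n. 1 + (v n k - v 0 k)) \<longlonglongrightarrow> V k"
      unfolding V_def by (subst (asm) sum_lessThan_telescope) (intro tendsto_intros)
    then show ?thesis by (simp add: v0)
  qed
  have Vrec: "V k = V (Suc k) - m\<^sup>2 * (V (Suc k) - V (Suc (Suc k))) + m * e k * V (Suc k)" for k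
  proof (rule LIMSEQ_unique)
    show "(\<lambda>j. v (Suc (Suc j)) k) \<longlonglongrightarrow> V k" by (intro LIMSEQ_Suc lim)
    show "(\<lambda>j. v (Suc (Suc j)) k) \<longlonglongrightarrow> V (Suc k) - m\<^sup>2 * (V (Suc k) - V (Suc (Suc k))) + m * e k * V (Suc k)"
      unfolding rec by (intro tendsto_intros LIMSEQ_Suc lim)
  qed
  have V1: "V \<longlonglongrightarrow> 1"
  proof -
    have le: "norm (V k - 1) \<le> B * ((\<Sum>n. norm (e n)) - (\<Sum>n<k. norm (e n)))" for k
    proof -
      have "norm (V k - 1) \<le> (\<Sum>j. norm (v (Suc j) k - v j k))"
        unfolding V_def using summable_norm[OF sd] by simp
      also have "\<dots> \<le> (\<Sum>j. B * norm (e (k + j)))"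
        by (rule suminf_le[OF vB sd sk])
      also have "\<dots> = B * (\<Sum>j. norm (e (j + k)))"
        using summable_ignore_initial_segment[OF sm, of k] by (simp add: suminf_mult add.commute)
      also have "\<dots> = B * ((\<Sum>n. norm (e n)) - (\<Sum>n<k. norm (e n)))"
        by (simp add: suminf_minus_initial_segment[OF sm])
      finally show ?thesis .
    qed
    have "(\<lambda>k. B * ((\<Sum>n. norm (e n)) - (\<Sum>n<k. norm (e n)))) \<longlonglongrightarrow>
       B * ((\<Sum>n. norm (e n)) - (\<Sum>n. norm (e n)))"
      by (intro tendsto_intros summable_LIMSEQ sm)
    then have lim0: "(\<lambda>k. B * ((\<Sum>n. norm (e n)) - (\<Sum>n<k. norm (e n)))) \<longlonglongrightarrow> 0"
      by simp
    have "(\<lambda>k. V k - 1) \<longlonglongrightarrow> 0"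
      by (rule Lim_null_comparison[OF always_eventually lim0]) (rule allI, rule le)
    then show ?thesis by (simp add: LIM_zero_iff)
  qed
  have "three_term (\<lambda>n. 1 / m - m + e n) (\<lambda>n. m ^ n * V n)"
    unfolding three_term_def
  proof
    fix n
    have "m ^ n * V n - m ^ Suc (Suc n) * V (Suc (Suc n)) =
       m ^ n * ((1 - m\<^sup>2 + m * e n) * V (Suc n))"
      by (subst Vrec[of n]) (simp add: algebra_simps power2_eq_square)
    also have "(1 - m\<^sup>2 + m * e n) = m * (1 / m - m + e n)"
      using m(2) by (simp add: field_simps power2_eq_square)
    finally show "m ^ n * V n - m ^ Suc (Suc n) * V (Suc (Suc n)) = (1 / m - m + e n) * (m ^ Suc n * V (Suc n))"
      by (simp add: algebra_simps)
  qed
  moreover have "(\<lambda>n. m ^ n * V n / m ^ n) \<longlonglongrightarrow> 1"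
    using V1 m(2) by simp
  ultimately show ?thesis by blast
qed

lemma power_times_convergent_tendsto_0:
  fixes m :: complex
  assumes m: "norm m < 1" "m \<noteq> 0" and "(\<lambda>n. X n / m ^ n) \<longlonglongrightarrow> c"
  shows "X \<longlonglongrightarrow> 0"
proof -
  have "(\<lambda>n. m ^ n * (X n / m ^ n)) \<longlonglongrightarrow> 0 * c"
    by (intro tendsto_mult LIMSEQ_power_zero assms)
  then show ?thesis using m by simp
qed

text \<open>The difference of two such solutions decays, hence is proportional to the first of
  them; being \<open>o(m\<^sup>n)\<close>, it is zero.\<close>

lemma jost_unique:
  fixes m :: complex
  assumes m: "norm m < 1" "m \<noteq> 0"
    and "three_term a X" "(\<lambda>n. X n / m ^ n) \<longlonglongrightarrow> c" 
    and "three_term a Y" "(\<lambda>n. Y n / m ^ n) \<longlonglongrightarrow> c" and "c \<noteq> 0"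
  shows "X = Y"
proof (rule ccontr)
  assume ne: "X \<noteq> Y"
  define Z where "Z = (\<lambda>n. X n - Y n)"
  have Z: "three_term a Z" "(\<lambda>n. Z n / m ^ n) \<longlonglongrightarrow> 0"
    using three_term_diff[OF assms(3,5)] tendsto_diff[OF assms(4,6)]
    by (simp_all add: Z_def diff_divide_distrib)
  have prp: "X 0 * Z (Suc 0) = X (Suc 0) * Z 0"
    using decaying_solutions_proportional[OF assms(3) Z(1)]
      power_times_convergent_tendsto_0[OF m] assms(4) Z(2) by blast
  have Zn: "\<not> (Z 0 = 0 \<and> Z (Suc 0) = 0)"
  proof
    assume "Z 0 = 0 \<and> Z (Suc 0) = 0"
    then have "Z n = 0" for n using three_term_eq_0[OF Z(1)] by blast
    then show False using ne by (auto simp: Z_def fun_eq_iff)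
  qed
  define x where "x = (if Z 0 = 0 then Z (Suc 0) else Z 0)"
  define y where "y = (if Z 0 = 0 then X (Suc 0) else X 0)"
  have x0: "x \<noteq> 0" using Zn by (auto simp: x_def)
  have "(\<lambda>n. x * X n) = (\<lambda>n. y * Z n)"
    by (rule three_term_unique[OF three_term_cmult[OF assms(3)] three_term_cmult[OF Z(1)]])
      (use prp in \<open>auto simp: x_def y_def mult.commute\<close>)
  then have "(\<lambda>n. x * (X n / m ^ n)) = (\<lambda>n. y * (Z n / m ^ n))"
    by (simp add: fun_eq_iff)
  moreover have "(\<lambda>n. x * (X n / m ^ n)) \<longlonglongrightarrow> x * c" by (intro tendsto_intros assms)
  moreover have "(\<lambda>n. y * (Z n / m ^ n)) \<longlonglongrightarrow> y * 0" by (intro tendsto_intros Z)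
  ultimately have "x * c = y * 0" using LIMSEQ_unique by metis
  then show False using x0 assms by simp
qed

section \<open>Continued fractions\<close>

fun cf_prod :: "(nat \<Rightarrow> complex) \<Rightarrow> nat \<Rightarrow> nat \<Rightarrow> complex" where
  "cf_prod a m 0 = 1"
| "cf_prod a m (Suc N) = cf_approx a m (Suc N) * cf_prod a (Suc m) N"

lemma Re_inverse_eq: "Re (1 / z) = (norm (1 / z))\<^sup>2 * Re z"
  by (simp add: Re_divide cmod_power2 norm_divide power_divide)

lemma Re_cf_approx_nonneg:
  assumes "\<And>k. k \<ge> m \<Longrightarrow> Re (a k) \<ge> 0"
  shows "Re (cf_approx a m N) \<ge> 0"
  using assms
proof (induction N arbitrary: m)
  case (Suc N)
  have "Re (a m) \<ge> 0" "Re (cf_approx a (Suc m) N) \<ge> 0"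
    using Suc.prems Suc.IH[of "Suc m"] by auto
  then show ?case unfolding cf_approx.simps Re_inverse_eq by (simp add: add_nonneg_nonneg)
qed simp

text \<open>This identity is the core of Pincherle's theorem. If \<open>X\<close> decays and the
  products stay bounded, the right-hand side tends to zero and the approximants converge to
  \<open>X\<^bsub>m+1\<^esub> / X\<^sub>m\<close>. In this form, without quotients, it also
  decides whether \<open>X\<^sub>m\<close> can vanish.\<close>

lemma cf_error:
  assumes X: "three_term a X" and a: "\<And>k. k \<ge> m \<Longrightarrow> Re (a k) > 0"
  shows "X (Suc m) - cf_approx a m N * X m = (-1) ^ N * cf_prod a m N * X (Suc (m + N))"
  using a
proof (induction N arbitrary: m)
  case (Suc N)
  define c where "c = cf_approx a m (Suc N)"
  define c' where "c' = cf_approx a (Suc m) N"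
  have "Re (a m + c') > 0"
    using Suc.prems[of m] Re_cf_approx_nonneg[of "Suc m" a N] Suc.prems
    by (simp add: c'_def less_imp_le add_pos_nonneg)
  then have "a m + c' \<noteq> 0" by (metis less_irrefl zero_complex.sel(1))
  then have c: "c * (a m + c') = 1" by (simp add: c_def c'_def)
  have IH: "X (Suc (Suc m)) - c' * X (Suc m) = (-1) ^ N * cf_prod a (Suc m) N * X (Suc (Suc m + N))"
    unfolding c'_def by (rule Suc.IH) (use Suc.prems in auto)
  have "X (Suc m) - c * X m = X (Suc m) - c * (X (Suc (Suc m)) + a m * X (Suc m))"
    using three_termD[OF X, of m] by (simp add: algebra_simps)
  also have "\<dots> = (c * (a m + c')) * X (Suc m) - c * (X (Suc (Suc m)) + a m * X (Suc m))"
    by (simp only: c mult_1)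
  also have "\<dots> = - c * (X (Suc (Suc m)) - c' * X (Suc m))"
    by (simp add: algebra_simps)
  also have "\<dots> = (-1) ^ Suc N * (c * cf_prod a (Suc m) N) * X (Suc (m + Suc N))"
    unfolding IH by simp
  finally show ?case by (simp add: c_def)
qed simp

text \<open>An energy estimate: \<open>Re c = \<bar>c\<bar>\<^sup>2 Re (1 / c)\<close> for an
  approximant \<open>c\<close>, and \<open>Re (1 / c) \<ge> d + Re c'\<close> for the
  approximant \<open>c'\<close> of the next tail.\<close>

lemma cf_prod_bound:
  assumes "d > 0" and a: "\<And>k. k \<ge> m \<Longrightarrow> Re (a k) \<ge> d"
  shows "d * (norm (cf_prod a m N))\<^sup>2 \<le> d + Re (cf_approx a m N)"
  using a
proof (induction N arbitrary: m)
  case (Suc N)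
  define c where "c = cf_approx a m (Suc N)"
  define c' where "c' = cf_approx a (Suc m) N"
  have IH: "d * (norm (cf_prod a (Suc m) N))\<^sup>2 \<le> d + Re c'"
    unfolding c'_def by (rule Suc.IH) (use Suc.prems in auto)
  have "d * (norm (cf_prod a m (Suc N)))\<^sup>2 = (norm c)\<^sup>2 * (d * (norm (cf_prod a (Suc m) N))\<^sup>2)"
    by (simp add: c_def norm_mult power_mult_distrib del: cf_approx.simps)
  also have "\<dots> \<le> (norm c)\<^sup>2 * (d + Re c')"
    by (intro mult_left_mono IH) auto
  also have "\<dots> \<le> (norm c)\<^sup>2 * Re (a m + c')"
    using Suc.prems[of m] by (intro mult_left_mono) auto
  also have "\<dots> = Re c"
    unfolding c_def c'_def cf_approx.simps Re_inverse_eq ..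
  finally show ?case using assms(1) by (simp add: c_def)
qed (use assms in simp)

lemma norm_cf_approx_le:
  assumes "d > 0" and a: "\<And>k. k \<ge> m \<Longrightarrow> Re (a k) \<ge> d"
  shows "norm (cf_approx a m N) \<le> 1 / d"
proof (cases N)
  case (Suc M)
  have "Re (cf_approx a (Suc m) M) \<ge> 0"
    by (rule Re_cf_approx_nonneg) (rule order_trans[OF less_imp_le[OF assms(1)] a], simp)
  then have "d \<le> Re (a m + cf_approx a (Suc m) M)" using a[of m] by simp
  also have "\<dots> \<le> norm (a m + cf_approx a (Suc m) M)" by (rule complex_Re_le_cmod)
  finally show ?thesis using assms(1) Suc by (simp add: norm_divide frac_le)
qed (use assms in simp)

text \<open>If \<open>X\<^sub>m\<close> were zero, the error identity would force
  \<open>X\<^bsub>m+1\<^esub> = 0\<close>; so the quotient makes sense for every nonzero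
  decaying solution.\<close>

lemma cf_converges:
  assumes X: "three_term a X" "X \<longlonglongrightarrow> 0" and d: "d > 0" and a: "\<And>k. k \<ge> m \<Longrightarrow> Re (a k) \<ge> d"
    and nz: "\<not> (X m = 0 \<and> X (Suc m) = 0)"
  shows "X m \<noteq> 0" "cf_approx a m \<longlonglongrightarrow> X (Suc m) / X m"
proof -
  have a': "\<And>k. k \<ge> m \<Longrightarrow> Re (a k) > 0" by (rule less_le_trans[OF d a])
  define B where "B = sqrt ((d + 1 / d) / d)"
  have B: "norm (cf_prod a m N) \<le> B" for N
  proof -
    have le: "d * (norm (cf_prod a m N))\<^sup>2 \<le> d + Re (cf_approx a m N)"
      by (rule cf_prod_bound[OF d a])
    have "norm (cf_approx a m N) \<le> 1 / d"
      by (rule norm_cf_approx_le[OF d]) (rule a)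
    then have "d + Re (cf_approx a m N) \<le> d + 1 / d"
      using complex_Re_le_cmod[of "cf_approx a m N"] by simp
    with le have "d * (norm (cf_prod a m N))\<^sup>2 \<le> d + 1 / d" by simp
    then have "(norm (cf_prod a m N))\<^sup>2 \<le> (d + 1 / d) / d"
      using d by (simp add: pos_le_divide_eq mult.commute)
    then show ?thesis unfolding B_def by (rule real_le_rsqrt)
  qed
  have lim: "(\<lambda>N. X (Suc m) - cf_approx a m N * X m) \<longlonglongrightarrow> 0"
  proof (rule Lim_null_comparison)
    show "\<forall>\<^sub>F N in sequentially. norm (X (Suc m) - cf_approx a m N * X m) \<le> B * norm (X (N + Suc m))"
    proof (intro always_eventually allI)
      fix N
      have eq: "X (Suc m) - cf_approx a m N * X m = (-1) ^ N * cf_prod a m N * X (Suc (m + N))"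
        by (rule cf_error[OF X(1)]) (rule a')
      show "norm (X (Suc m) - cf_approx a m N * X m) \<le> B * norm (X (N + Suc m))"
        unfolding eq using B[of N]
        by (simp add: norm_mult norm_power add.commute mult_right_mono)
    qed
    have "(\<lambda>N. B * norm (X (N + Suc m))) \<longlonglongrightarrow> B * norm (0::complex)"
      by (intro tendsto_intros LIMSEQ_ignore_initial_segment X)
    then show "(\<lambda>N. B * norm (X (N + Suc m))) \<longlonglongrightarrow> 0" by simp
  qed
  show nz': "X m \<noteq> 0"
  proof
    assume "X m = 0"
    with lim have "X (Suc m) = 0" by (simp add: LIMSEQ_const_iff)
    with nz \<open>X m = 0\<close> show False by simp
  qed
  have "(\<lambda>N. (X (Suc m) - (X (Suc m) - cf_approx a m N * X m)) / X m) \<longlonglongrightarrow> (X (Suc m) - 0) / X m"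
    by (intro tendsto_intros lim nz')
  then show "cf_approx a m \<longlonglongrightarrow> X (Suc m) / X m"
    using nz' by simp
qed

section \<open>Fredholm determinants of semiseparable kernels\<close>

text \<open>Expand the minor linearly in the row \<open>m\<close>. The part with a copy of the
  row \<open>m'\<close> vanishes, since composing a permutation with the transposition of
  \<open>m\<close> and \<open>m'\<close> changes its sign; the part with the diagonal entry
  \<open>d\<close> keeps only the permutations that fix \<open>m\<close>.\<close>

lemma principal_minor_elimination:
  assumes fin: "finite F" and m: "m \<notin> F" and m': "m' \<in> F"
    and row: "\<And>j. j \<in> insert m F \<Longrightarrow> a m j = t * a m' j + (if j = m then d else 0)"
  shows "principal_minor a (insert m F) = d * principal_minor a F"
proof -
  let ?P = "{\<pi>. \<pi> permutes insert m F}"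
  let ?\<tau> = "Transposition.transpose m m'"
  have finP: "finite ?P" by (rule finite_permutations) (use fin in simp)
  have \<tau>: "?\<tau> permutes insert m F" by (rule permutes_swap_id) (use m' in auto)
  define f where "f = (\<lambda>\<pi>. of_int (sign \<pi>) * (a m' (\<pi> m) * (\<Prod>i\<in>F. a i (\<pi> i))))"
  define g where "g = (\<lambda>\<pi>. of_int (sign \<pi>) * ((if \<pi> m = m then d else 0) * (\<Prod>i\<in>F. a i (\<pi> i))))"
  have "principal_minor a (insert m F) = (\<Sum>\<pi>\<in>?P. t * f \<pi> + g \<pi>)"
    unfolding principal_minor_def
  proof (rule sum.cong[OF refl])
    fix \<pi> assume "\<pi> \<in> ?P"
    then have "\<pi> m \<in> insert m F" using permutes_in_image[of \<pi> "insert m F" m] by blast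
    from row[OF this] show "of_int (sign \<pi>) * (\<Prod>i\<in>insert m F. a i (\<pi> i)) = t * f \<pi> + g \<pi>"
      using fin m by (simp add: f_def g_def algebra_simps)
  qed
  also have "\<dots> = t * sum f ?P + sum g ?P"
    by (simp add: sum.distrib sum_distrib_left)
  also have "sum f ?P = 0"
  proof -
    have "sum f ?P = (\<Sum>\<pi>\<in>?P. f (\<pi> \<circ> ?\<tau>))"
      by (rule sum_permutations_compose_right[OF \<tau>])
    also have "\<dots> = (\<Sum>\<pi>\<in>?P. - f \<pi>)"
    proof (rule sum.cong[OF refl])
      fix \<pi> assume "\<pi> \<in> ?P"
      then have "permutation \<pi>" using fin by (auto simp: permutation_permutes)
      then have s: "sign (\<pi> \<circ> ?\<tau>) = - sign \<pi>"
        using m m' by (subst sign_compose) (auto simp: sign_swap_id permutation_swap_id)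
      have "(\<Prod>i\<in>F. a i ((\<pi> \<circ> ?\<tau>) i)) = a m' (\<pi> m) * (\<Prod>i\<in>F - {m'}. a i ((\<pi> \<circ> ?\<tau>) i))"
        by (subst prod.remove[OF fin m']) simp
      also have "(\<Prod>i\<in>F - {m'}. a i ((\<pi> \<circ> ?\<tau>) i)) = (\<Prod>i\<in>F - {m'}. a i (\<pi> i))"
        by (rule prod.cong[OF refl]) (use m in \<open>auto simp: Transposition.transpose_def\<close>)
      finally have p1: "(\<Prod>i\<in>F. a i ((\<pi> \<circ> ?\<tau>) i)) = a m' (\<pi> m) * (\<Prod>i\<in>F - {m'}. a i (\<pi> i))" .
      have p2: "(\<Prod>i\<in>F. a i (\<pi> i)) = a m' (\<pi> m') * (\<Prod>i\<in>F - {m'}. a i (\<pi> i))"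
        by (rule prod.remove[OF fin m'])
      show "f (\<pi> \<circ> ?\<tau>) = - f \<pi>"
        unfolding f_def p1 p2 s by simp
    qed
    also have "\<dots> = - sum f ?P" by (simp add: sum_negf)
    finally show ?thesis by simp
  qed
  also have "sum g ?P = (\<Sum>\<pi> | \<pi> permutes F. g \<pi>)"
  proof (rule sum.mono_neutral_right[OF finP])
    show "{\<pi>. \<pi> permutes F} \<subseteq> ?P" by (auto intro: permutes_subset)
    show "\<forall>\<pi>\<in>?P - {\<pi>. \<pi> permutes F}. g \<pi> = 0"
      using permutes_superset[of _ "insert m F" F] m by (auto simp: g_def)
  qed
  also have "\<dots> = d * principal_minor a F"
    unfolding principal_minor_def sum_distrib_left
    by (rule sum.cong[OF refl]) (use m in \<open>auto simp: g_def permutes_not_in\<close>)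
  finally show ?thesis by simp
qed

lemma principal_minor_empty: "principal_minor a {} = 1"
  by (simp add: principal_minor_def)

lemma principal_minor_singleton: "principal_minor a {m} = a m m"
  by (simp add: principal_minor_def)

lemma principal_minor_zero_row:
  assumes "finite F" "x \<in> F" "\<And>y. a x y = 0"
  shows "principal_minor a F = 0"
proof -
  have "(\<Prod>i\<in>F. a i (\<pi> i)) = 0" for \<pi>
    using assms by (metis prod_zero)
  then show ?thesis by (simp add: principal_minor_def)
qed

lemma sum_Pow_lessThan_Suc:
  "sum f (Pow {..<Suc N}) = sum f (Pow {..<N}) + (\<Sum>F\<in>Pow {..<N}. f (insert N F))"
proof -
  have "inj_on (insert N) (Pow {..<N})"
    by (intro inj_onI) (auto dest: insert_ident[THEN iffD1, rotated -1])
  then have "(\<Sum>F\<in>insert N ` Pow {..<N}. f F) = (\<Sum>F\<in>Pow {..<N}. f (insert N F))"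
    by (simp add: sum.reindex)
  then show ?thesis
    unfolding lessThan_Suc Pow_insert
    by (subst sum.union_disjoint) auto
qed

text \<open>The sum over all finite index sets converges absolutely, because the sum of
  \<open>\<Prod>\<^bsub>m\<in>F\<^esub> \<epsilon>\<^sub>m\<close> over the subsets
  \<open>F\<close> of \<open>{..<N}\<close> is \<open>\<Prod>\<^bsub>m<N\<^esub> (1 +
  \<epsilon>\<^sub>m) \<le> exp (\<Sum>\<^sub>m \<epsilon>\<^sub>m)\<close>. So it may be summed
  by cardinality, which is the definition of the determinant, or along the sets of subsets of
  \<open>{..<N}\<close>. The injection \<open>\<iota>\<close> allows a matrix whose other rows
  are zero.\<close>

lemma fredholm_det_eq_limit:
  fixes \<iota> :: "nat \<Rightarrow> 'b" and \<epsilon> :: "nat \<Rightarrow> real"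
  assumes inj: "inj \<iota>" and rows: "\<And>x y. x \<notin> range \<iota> \<Longrightarrow> a x y = 0"
    and eps: "\<And>m. \<epsilon> m \<ge> 0" "summable \<epsilon>"
    and le: "\<And>F. finite F \<Longrightarrow> norm (principal_minor a (\<iota> ` F)) \<le> (\<Prod>m\<in>F. \<epsilon> m)"
  shows "(\<lambda>N. \<Sum>F\<in>Pow {..<N}. principal_minor a (\<iota> ` F)) \<longlonglongrightarrow> fredholm_det_I_plus a"
proof -
  define M where "M = (\<lambda>F. principal_minor a (\<iota> ` F))"
  let ?fin = "{F::nat set. finite F}"
  have "(\<lambda>F. \<Prod>m\<in>F. \<epsilon> m) summable_on ?fin"
  proof (rule nonneg_bounded_partial_sums_imp_summable_on)
    show "\<forall>\<^sub>F X in finite_subsets_at_top ?fin. (\<Sum>F\<in>X. \<Prod>m\<in>F. \<epsilon> m) \<le> exp (suminf \<epsilon>)"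
    proof (rule eventually_finite_subsets_at_top_weakI)
      fix X assume X: "finite X" "X \<subseteq> ?fin"
      then have "finite (\<Union>X)" by auto
      then obtain N where N: "\<Union>X \<subseteq> {..<N}"
        by (meson finite_nat_bounded)
      have "(\<Sum>F\<in>X. \<Prod>m\<in>F. \<epsilon> m) \<le> (\<Sum>F\<in>Pow {..<N}. \<Prod>m\<in>F. \<epsilon> m)"
        using N by (intro sum_mono2 prod_nonneg) (auto simp: eps)
      also have "\<dots> = (\<Prod>m<N. \<epsilon> m + 1)"
        by (subst prod_add) auto
      also have "\<dots> \<le> (\<Prod>m<N. exp (\<epsilon> m))"
        by (intro prod_mono) (auto simp: eps add.commute intro: exp_ge_add_one_self)
      also have "\<dots> = exp (\<Sum>m<N. \<epsilon> m)" by (simp add: exp_sum)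
      also have "\<dots> \<le> exp (suminf \<epsilon>)"
        by (simp, intro sum_le_suminf eps) (auto simp: eps)
      finally show "(\<Sum>F\<in>X. \<Prod>m\<in>F. \<epsilon> m) \<le> exp (suminf \<epsilon>)" .
    qed
  qed (auto intro: prod_nonneg eps)
  then have "(\<lambda>F. norm (M F)) summable_on ?fin"
    by (rule Infinite_Sum.abs_summable_on_comparison_test') (use le in \<open>auto simp: M_def\<close>)
  then have sM: "M summable_on ?fin" by (rule abs_summable_summable)
  define S where "S = infsum M ?fin"
  have S: "(M has_sum S) ?fin" unfolding S_def using sM by (rule has_sum_infsum)
  have lim: "(\<lambda>N. \<Sum>F\<in>Pow {..<N}. M F) \<longlonglongrightarrow> S"
  proof -
    have "filterlim (\<lambda>N. Pow {..<N}) (finite_subsets_at_top ?fin) sequentially"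
      unfolding filterlim_finite_subsets_at_top
    proof (intro allI impI)
      fix X assume X: "finite X \<and> X \<subseteq> ?fin"
      then have "finite (\<Union>X)" by auto
      then obtain N where N: "\<Union>X \<subseteq> {..<N}"
        by (meson finite_nat_bounded)
      show "\<forall>\<^sub>F n in sequentially. finite (Pow {..<n}) \<and> X \<subseteq> Pow {..<n} \<and> Pow {..<n} \<subseteq> ?fin"
        using eventually_ge_at_top[of N]
      proof eventually_elim
        case (elim n)
        then show ?case using N by (auto dest: finite_subset)
      qed
    qed
    with S show ?thesis unfolding has_sum_def by (rule filterlim_compose)
  qed
  let ?B = "\<lambda>k. {F::nat set. finite F \<and> card F = k}"
  have "((\<lambda>(k, F). M F) has_sum S) (Sigma UNIV ?B)"
    using S by (subst has_sum_reindex_bij_witness[of _ "\<lambda>F. (card F, F)" snd ?fin M]) auto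
  moreover have "(M has_sum infsum M (?B k)) (?B k)" for k
    by (intro has_sum_infsum summable_on_subset_banach[OF sM]) auto
  then have "((\<lambda>F. case (k, F) of (k, F) \<Rightarrow> M F) has_sum infsum M (?B k)) (?B k)" for k
    by simp
  ultimately have "((\<lambda>k. infsum M (?B k)) has_sum S) UNIV"
    by (rule has_sum_SigmaD)
  then have "(\<lambda>k. infsum M (?B k)) sums S" by (rule has_sum_imp_sums)
  moreover have "ext_power_trace a k = infsum M (?B k)" for k
  proof -
    have "ext_power_trace a k = infsum (principal_minor a) ((`) \<iota> ` ?B k)"
      unfolding ext_power_trace_def
    proof (rule infsum_cong_neutral)
      fix F assume F: "F \<in> {F. finite F \<and> card F = k} - (`) \<iota> ` ?B k"
      have "\<not> F \<subseteq> range \<iota>"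
      proof
        assume "F \<subseteq> range \<iota>"
        then obtain G where G: "F = \<iota> ` G" by (meson subset_imageE)
        then have "finite G" "card G = k"
          using F inj by (auto simp: card_image inj_on_subset finite_image_iff)
        with F G show False by auto
      qed
      then obtain x where "x \<in> F" "x \<notin> range \<iota>" by auto
      then show "principal_minor a F = 0"
        using F rows by (intro principal_minor_zero_row[of F x]) auto
    next
      fix F assume "F \<in> (`) \<iota> ` ?B k - {F. finite F \<and> card F = k}"
      then show "principal_minor a F = 0"
        using inj by (auto simp: card_image inj_on_subset)
    qed auto
    also have "\<dots> = infsum M (?B k)"
      using inj by (subst infsum_reindex)
        (auto simp: M_def o_def inj_on_def inj_image_eq_iff)
    finally show ?thesis .
  qed
  ultimately have "fredholm_det_I_plus a = S"
    by (simp add: fredholm_det_I_plus_def sums_iff)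
  with lim show ?thesis by (simp add: M_def)
qed


text \<open>Left of the diagonal the row \<open>m\<close> is a multiple of the row of the
  largest index \<open>Max F\<close>, because there both depend on the column through the same
  factor; subtracting this multiple leaves only the diagonal entry.\<close>

lemma semiseparable_minor_insert:
  fixes \<iota> :: "nat \<Rightarrow> 'b"
  assumes inj: "inj \<iota>"
    and ent: "\<And>i j. a (\<iota> i) (\<iota> j) = c i * b j * \<phi> (min i j) * \<psi> (max i j)"
    and nz: "\<And>i. c i \<noteq> 0" "\<And>i. \<psi> i \<noteq> 0"
    and F: "finite F" "\<And>i. i \<in> F \<Longrightarrow> i < m"
  shows "principal_minor a (\<iota> ` insert m F) =
    c m * b m * \<psi> m * (\<phi> m - (if F = {} then 0 else \<psi> m * \<phi> (Max F) / \<psi> (Max F))) *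
    principal_minor a (\<iota> ` F)"
proof (cases "F = {}")
  case True
  then show ?thesis by (simp add: principal_minor_singleton principal_minor_empty ent)
next
  case False
  define m' where "m' = Max F"
  have m': "m' \<in> F" "\<And>j. j \<in> F \<Longrightarrow> j \<le> m'" unfolding m'_def using F(1) False by auto
  have mm: "m' < m" "m \<notin> F" using F(2) m'(1) by auto
  have "principal_minor a (insert (\<iota> m) (\<iota> ` F)) =
    (c m * b m * \<psi> m * (\<phi> m - \<psi> m * \<phi> m' / \<psi> m')) * principal_minor a (\<iota> ` F)"
  proof (rule principal_minor_elimination[of _ _ "\<iota> m'" _ "c m * \<psi> m / (c m' * \<psi> m')"])
    show "\<iota> m \<notin> \<iota> ` F" using inj mm by (auto dest: injD)
    fix j assume "j \<in> insert (\<iota> m) (\<iota> ` F)"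
    then consider "j = \<iota> m" | i where "j = \<iota> i" "i \<in> F" by auto
    then show "a (\<iota> m) j = c m * \<psi> m / (c m' * \<psi> m') * a (\<iota> m') j +
      (if j = \<iota> m then c m * b m * \<psi> m * (\<phi> m - \<psi> m * \<phi> m' / \<psi> m') else 0)"
    proof cases
      case 1
      then show ?thesis using nz mm by (simp add: ent field_simps)
    next
      case 2
      then have "i \<le> m'" "i < m" "\<iota> i \<noteq> \<iota> m" using m'(2) F(2) inj mm by (auto dest: injD)
      then show ?thesis using nz mm 2 by (simp add: ent field_simps max_absorb1 min_absorb2)
    qed
  qed (use F m' in auto)
  then show ?thesis using False by (simp add: m'_def)
qed

lemma norm_semiseparable_minor_le:
  fixes \<iota> :: "nat \<Rightarrow> 'b"
  assumes inj: "inj \<iota>"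
    and ent: "\<And>i j. a (\<iota> i) (\<iota> j) = c i * b j * \<phi> (min i j) * \<psi> (max i j)"
    and nz: "\<And>i. c i \<noteq> 0" "\<And>i. \<psi> i \<noteq> 0"
    and le: "\<And>m k. k \<le> m \<Longrightarrow> norm (c m * b m * \<psi> m * (\<psi> m * \<phi> k / \<psi> k)) \<le> \<epsilon> m"
    and F: "finite F"
  shows "norm (principal_minor a (\<iota> ` F)) \<le> (\<Prod>m\<in>F. 2 * \<epsilon> m)"
  using F
proof (induction F rule: finite_linorder_max_induct)
  case empty
  then show ?case by (simp add: principal_minor_empty)
next
  case (insert m F)
  have eps: "\<epsilon> k \<ge> 0" for k using order_trans[OF norm_ge_zero le[of k k]] by simp
  define h where "h = (if F = {} then 0 else \<psi> m * \<phi> (Max F) / \<psi> (Max F))"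
  have 1: "norm (c m * b m * \<psi> m * \<phi> m) \<le> \<epsilon> m"
    using le[of m m] nz(2)[of m] by simp
  have 2: "norm (c m * b m * \<psi> m * h) \<le> \<epsilon> m"
  proof (cases "F = {}")
    case False
    then have "Max F \<le> m" using insert by (simp add: less_imp_le)
    then show ?thesis using le[of "Max F" m] False by (simp add: h_def)
  qed (use eps in \<open>simp add: h_def\<close>)
  have "principal_minor a (\<iota> ` insert m F) =
    c m * b m * \<psi> m * (\<phi> m - h) * principal_minor a (\<iota> ` F)"
    unfolding h_def by (subst semiseparable_minor_insert[where a = a and \<iota> = \<iota> and c = c and b = b and \<phi> = \<phi> and \<psi> = \<psi>, OF inj ent nz])
      (use insert in auto)
  also have "c m * b m * \<psi> m * (\<phi> m - h) = c m * b m * \<psi> m * \<phi> m - c m * b m * \<psi> m * h"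
    by (simp add: algebra_simps)
  finally have "norm (principal_minor a (\<iota> ` insert m F)) =
    norm (c m * b m * \<psi> m * \<phi> m - c m * b m * \<psi> m * h) * norm (principal_minor a (\<iota> ` F))"
    by (simp add: norm_mult)
  also have "\<dots> \<le> (2 * \<epsilon> m) * (\<Prod>m\<in>F. 2 * \<epsilon> m)"
  proof (rule mult_mono)
    show "norm (c m * b m * \<psi> m * \<phi> m - c m * b m * \<psi> m * h) \<le> 2 * \<epsilon> m"
      using norm_triangle_ineq4[of "c m * b m * \<psi> m * \<phi> m" "c m * b m * \<psi> m * h"] 1 2 by linarith
  qed (use insert eps in auto)
  also have "\<dots> = (\<Prod>m\<in>insert m F. 2 * \<epsilon> m)"
    using insert by (subst prod.insert) auto
  finally show ?case .
qed

text \<open>Both \<open>m\<close> and \<open>- 1 / m\<close> are characteristic roots of the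
  recurrence with coefficient \<open>l\<close>, and the left-hand side removes the contribution
  of the root \<open>m\<close>.\<close>

lemma free_solution_power:
  assumes "m \<noteq> 0" "l = 1 / m - m"
  shows "initial_solution (\<lambda>_. l) 0 1 (Suc k) - m * initial_solution (\<lambda>_. l) 0 1 k = (- 1 / m) ^ k"
proof (induction k)
  case (Suc k)
  have "initial_solution (\<lambda>_. l) 0 1 (Suc (Suc k)) - m * initial_solution (\<lambda>_. l) 0 1 (Suc k) =
    (- 1 / m) * (initial_solution (\<lambda>_. l) 0 1 (Suc k) - m * initial_solution (\<lambda>_. l) 0 1 k)"
    unfolding initial_solution.simps assms(2) using assms(1)
    by (simp add: left_diff_distrib right_diff_distrib)
  then show ?case unfolding Suc by simp
qed simp

text \<open>The regular solution of the unperturbed recurrence grows at most like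
  \<open>m\<^bsup>-k\<^esup>\<close>, which keeps the diagonal of its Green function
  bounded.\<close>

lemma norm_free_solution_le:
  assumes "m \<noteq> 0" "norm m < 1" "l = 1 / m - m"
  shows "norm (initial_solution (\<lambda>_. l) 0 1 (Suc k) * m ^ k) \<le> 1 / (1 - (norm m)\<^sup>2)"
proof (induction k)
  case 0
  show ?case using assms by (simp add: power_le_one field_simps power_less_one_iff)
next
  case (Suc k)
  let ?f = "initial_solution (\<lambda>_. l) 0 1"
  have m2: "(norm m)\<^sup>2 < 1" using assms by (simp add: power_less_one_iff)
  have "?f (Suc (Suc k)) * m ^ Suc k = m\<^sup>2 * (?f (Suc k) * m ^ k) + (- 1 / m) ^ Suc k * m ^ Suc k"
    unfolding free_solution_power[OF assms(1,3), symmetric] by (simp add: algebra_simps power2_eq_square)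
  also have "(- 1 / m) ^ Suc k * m ^ Suc k = (- 1) ^ Suc k"
    using assms(1) by (simp only: power_mult_distrib[symmetric]) simp
  finally have "norm (?f (Suc (Suc k)) * m ^ Suc k) \<le> norm (m\<^sup>2 * (?f (Suc k) * m ^ k)) + norm ((- 1 :: complex) ^ Suc k)"
    using norm_triangle_ineq by metis
  also have "\<dots> = (norm m)\<^sup>2 * norm (?f (Suc k) * m ^ k) + 1"
    by (simp add: norm_mult norm_power)
  also have "\<dots> \<le> (norm m)\<^sup>2 * (1 / (1 - (norm m)\<^sup>2)) + 1"
    by (intro add_mono mult_left_mono Suc) auto
  also have "\<dots> = 1 / (1 - (norm m)\<^sup>2)" using m2 by (simp add: field_simps)
  finally show ?case .
qed

text \<open>Let \<open>D N\<close> be the sum of the minors over the subsets of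
  \<open>{..<N}\<close> and let \<open>H N\<close> be the same sum with each minor weighted by
  the ratio \<open>\<phi> / \<psi>\<close> at its largest index. Removing the largest index
  turns \<open>(D, H)\<close> into the solution of a linear recursion, namely variation of
  constants for the regular solution \<open>X\<close> of the perturbed recurrence. This
  expresses \<open>D N\<close> by two neighbouring entries of \<open>X\<close>, and the limit is
  read off from the Casoratian of \<open>X\<close> and \<open>J\<close>.\<close>

lemma fredholm_det_semiseparable:
  fixes \<iota> :: "nat \<Rightarrow> 'b" and m l :: complex
  assumes m: "m \<noteq> 0" "norm m < 1" and l: "l = 1 / m - m"
    and e: "summable (\<lambda>n. norm (e n))"
    and inj: "inj \<iota>" and rows: "\<And>x y. x \<notin> range \<iota> \<Longrightarrow> a x y = 0"
    and ent: "\<And>i j. a (\<iota> i) (\<iota> j) =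
      c i * b j * initial_solution (\<lambda>_. l) 0 1 (Suc (min i j)) * m ^ max i j"
    and c: "\<And>i. c i \<noteq> 0" "\<And>i. c i * b i = e i * m * (- 1) ^ i"
    and J: "three_term (\<lambda>n. l + e n) J" "(\<lambda>n. J n / m ^ n) \<longlonglongrightarrow> 1"
  shows "fredholm_det_I_plus a = J 0"
proof -
  define \<phi> where "\<phi> = (\<lambda>i. initial_solution (\<lambda>_. l) 0 1 (Suc i))"
  define \<psi> where "\<psi> = (\<lambda>i::nat. m ^ i)"
  define \<kappa> where "\<kappa> = (\<lambda>i. c i * b i * \<psi> i)"
  define M where "M = (\<lambda>F. principal_minor a (\<iota> ` F))"
  define B where "B = 1 / (1 - (norm m)\<^sup>2)"
  have B0: "B \<ge> 0" using m by (simp add: B_def power_le_one)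
  have ent': "a (\<iota> i) (\<iota> j) = c i * b j * \<phi> (min i j) * \<psi> (max i j)" for i j
    by (simp add: ent \<phi>_def \<psi>_def)
  have \<psi>0: "\<psi> i \<noteq> 0" for i using m by (simp add: \<psi>_def)
  have \<kappa>: "\<kappa> i = e i * m * (- m) ^ i" for i
    by (simp add: \<kappa>_def c \<psi>_def power_minus[of m])
  have le: "norm (c i * b i * \<psi> i * (\<psi> i * \<phi> k / \<psi> k)) \<le> norm (e i) * B" if "k \<le> i" for i k
  proof -
    define D where "D = i - k"
    have i: "i = k + D" using that by (simp add: D_def)
    have "c i * b i * \<psi> i * (\<psi> i * \<phi> k / \<psi> k) = e i * (m * (- m) ^ i * m ^ D / m ^ k) * (\<phi> k * m ^ k)"
      unfolding \<kappa>[unfolded \<kappa>_def] using m(1) by (simp add: \<psi>_def i power_add field_simps)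
    also have "m * (- m) ^ i * m ^ D / m ^ k = m * (- 1) ^ i * m ^ D * m ^ D"
      using m(1) by (subst power_minus) (simp add: i power_add)
    finally have "norm (c i * b i * \<psi> i * (\<psi> i * \<phi> k / \<psi> k)) =
      norm (e i) * ((norm m * norm m ^ D * norm m ^ D) * norm (\<phi> k * m ^ k))"
      by (simp add: norm_mult norm_power)
    also have "\<dots> \<le> norm (e i) * (1 * B)"
    proof (intro mult_left_mono mult_mono)
      show "norm (\<phi> k * m ^ k) \<le> B"
        unfolding \<phi>_def B_def by (rule norm_free_solution_le[OF m l])
      have "norm m ^ D \<le> 1" using m by (simp add: power_le_one)
      then show "norm m * norm m ^ D * norm m ^ D \<le> 1"
        using m by (intro mult_le_one) auto
    qed auto
    finally show ?thesis by simp
  qed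
  have "(\<lambda>N. \<Sum>F\<in>Pow {..<N}. principal_minor a (\<iota> ` F)) \<longlonglongrightarrow> fredholm_det_I_plus a"
  proof (rule fredholm_det_eq_limit[OF inj rows, where \<epsilon> = "\<lambda>i. 2 * (norm (e i) * B)"])
    show "summable (\<lambda>i. 2 * (norm (e i) * B))"
      by (intro summable_mult summable_mult2 e)
    show "norm (principal_minor a (\<iota> ` F)) \<le> (\<Prod>m\<in>F. 2 * (norm (e m) * B))" if "finite F" for F
      by (rule norm_semiseparable_minor_le[where a = a and \<iota> = \<iota> and c = c and b = b and \<phi> = \<phi> and \<psi> = \<psi>, OF inj ent' c(1) \<psi>0 le that])
  qed (use B0 in auto)
  then have lim: "(\<lambda>N. \<Sum>F\<in>Pow {..<N}. M F) \<longlonglongrightarrow> fredholm_det_I_plus a"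
    by (simp add: M_def)

  \<comment> \<open>The weight of the empty set is the ratio at the fictitious index \<open>-1\<close>, where the regular
    solution vanishes.\<close>
  define h where "h = (\<lambda>F. if F = {} then 0 else \<phi> (Max F) / \<psi> (Max F))"
  define D where "D = (\<lambda>N. \<Sum>F\<in>Pow {..<N}. M F)"
  define H where "H = (\<lambda>N. \<Sum>F\<in>Pow {..<N}. M F * h F)"
  have Mins: "M (insert N F) = \<kappa> N * (\<phi> N - \<psi> N * h F) * M F" if F: "F \<in> Pow {..<N}" for N F
  proof -
    have "M (insert N F) =
      c N * b N * \<psi> N * (\<phi> N - (if F = {} then 0 else \<psi> N * \<phi> (Max F) / \<psi> (Max F))) * M F"
      unfolding M_def
      by (rule semiseparable_minor_insert[where a = a and \<iota> = \<iota> and c = c and b = b and \<phi> = \<phi> and \<psi> = \<psi>, OF inj ent' c(1) \<psi>0])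
        (use F in \<open>auto intro: finite_subset\<close>)
    then show ?thesis by (simp add: \<kappa>_def h_def)
  qed
  have hins: "h (insert N F) = \<phi> N / \<psi> N" if "F \<in> Pow {..<N}" for N F
  proof -
    have "Max (insert N F) = N"
      by (rule Max_eqI) (use that in \<open>auto intro: finite_subset\<close>)
    then show ?thesis by (simp add: h_def)
  qed
  define E where "E = (\<lambda>N. \<kappa> N * (\<phi> N * D N - \<psi> N * H N))"
  have "(\<Sum>F\<in>Pow {..<N}. M (insert N F)) = (\<Sum>F\<in>Pow {..<N}. \<kappa> N * (\<phi> N * M F - \<psi> N * (M F * h F)))" for N
    by (rule sum.cong[OF refl]) (simp add: Mins algebra_simps)
  then have Esum: "(\<Sum>F\<in>Pow {..<N}. M (insert N F)) = E N" for N
    by (simp add: E_def D_def H_def sum_subtractf flip: sum_distrib_left)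
  have DSuc: "D (Suc N) = D N + E N" for N
    unfolding D_def sum_Pow_lessThan_Suc Esum ..
  have "(\<Sum>F\<in>Pow {..<N}. M (insert N F) * h (insert N F)) = (\<Sum>F\<in>Pow {..<N}. M (insert N F)) * (\<phi> N / \<psi> N)" for N
    unfolding sum_distrib_right by (rule sum.cong[OF refl]) (simp add: hins)
  then have HSuc: "H (Suc N) = H N + E N * (\<phi> N / \<psi> N)" for N
    unfolding H_def sum_Pow_lessThan_Suc Esum by simp
  define X where "X = initial_solution (\<lambda>n. l + e n) 0 1"
  have X: "three_term (\<lambda>n. l + e n) X" "X 0 = 0" "X (Suc 0) = 1"
    unfolding X_def by (rule three_term_initial_solution) simp_all
  have DX: "D N = (- m) ^ N * (X (Suc N) - m * X N) \<and> X (Suc N) = \<phi> N * D N - m ^ N * H N" for N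
  proof (induction N)
    case 0
    show ?case by (simp add: D_def H_def h_def X M_def principal_minor_empty \<phi>_def)
  next
    case (Suc N)
    define x0 x1 x2 where "x0 = X N" and "x1 = X (Suc N)" and "x2 = X (Suc (Suc N))"
    have x2: "x2 = x0 - (l + e N) * x1"
      unfolding x0_def x1_def x2_def by (rule three_term_Suc_Suc[OF X(1)])
    have IH: "D N = (- m) ^ N * (x1 - m * x0)" "x1 = \<phi> N * D N - m ^ N * H N"
      using Suc unfolding x0_def x1_def by blast+
    have E: "E N = e N * m * (- m) ^ N * x1"
      by (simp add: E_def \<kappa> IH(2) \<psi>_def)
    have D1: "D (Suc N) = (- m) ^ Suc N * (x2 - m * x1)"
    proof -
      have "m * x2 = m * x0 - (1 - m\<^sup>2 + m * e N) * x1"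
        unfolding x2 l using m(1) by (simp add: field_simps power2_eq_square)
      then have "- (m * x2) + m\<^sup>2 * x1 = x1 - m * x0 + e N * m * x1"
        by (simp add: algebra_simps)
      then have "(- m) ^ N * (- (m * x2) + m\<^sup>2 * x1) = (- m) ^ N * (x1 - m * x0 + e N * m * x1)"
        by simp
      then show ?thesis unfolding DSuc E IH(1) by (simp add: algebra_simps power2_eq_square)
    qed
    have "\<phi> (Suc N) * D (Suc N) - m ^ Suc N * H (Suc N) =
      \<phi> (Suc N) * D (Suc N) - m * (m ^ N * H N) - m * (E N * \<phi> N)"
      unfolding HSuc \<psi>_def using m(1) by (simp add: algebra_simps)
    also have "m ^ N * H N = \<phi> N * D N - x1" using IH(2) by simp
    also have "\<phi> (Suc N) * D (Suc N) - m * (\<phi> N * D N - x1) - m * (E N * \<phi> N) =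
      (\<phi> (Suc N) - m * \<phi> N) * D (Suc N) + m * x1"
      unfolding DSuc by (simp add: algebra_simps)
    also have "\<phi> (Suc N) - m * \<phi> N = (- 1 / m) ^ Suc N"
      unfolding \<phi>_def by (rule free_solution_power[OF m(1) l])
    also have "(- 1 / m) ^ Suc N * D (Suc N) = ((- 1 / m) ^ Suc N * (- m) ^ Suc N) * (x2 - m * x1)"
      unfolding D1 by (simp only: mult.assoc)
    also have "(- 1 / m) ^ Suc N * (- m) ^ Suc N = 1"
      using m(1) by (simp only: power_mult_distrib[symmetric]) simp
    finally have "x2 = \<phi> (Suc N) * D (Suc N) - m ^ Suc N * H (Suc N)" by simp
    with D1 show ?case by (simp only: x1_def x2_def)
  qed

  define s where "s = (\<lambda>N. (- m) ^ N * X N)"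
  have Ds: "m * D N = - s (Suc N) - m\<^sup>2 * s N" for N
    unfolding conjunct1[OF DX] by (simp add: s_def algebra_simps power2_eq_square)
  have "Bseq D" using lim unfolding D_def by (rule convergent_imp_Bseq[OF convergentI])
  then obtain K where K: "\<And>N. norm (D N) \<le> K" by (auto simp: Bseq_def)
  \<comment> \<open>A convergent sequence \<open>D\<close> makes \<open>s\<close> bounded, since \<open>s\<close> is driven by \<open>D\<close> through a contraction.
    The convergence of \<open>D\<close> thus bounds the growth of \<open>X\<close>.\<close>
  have s_le: "norm (s N) \<le> K * B" for N
  proof (induction N)
    case 0
    show ?case using order_trans[OF norm_ge_zero K[of 0]] B0 by (simp add: s_def X)
  next
    case (Suc N)
    have "s (Suc N) = - (m * D N) - m\<^sup>2 * s N" using Ds[of N] by simp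
    then have "norm (s (Suc N)) \<le> norm (m * D N) + norm (m\<^sup>2 * s N)"
      using norm_triangle_ineq4[of "- (m * D N)" "m\<^sup>2 * s N"] by simp
    also have "\<dots> \<le> 1 * K + (norm m)\<^sup>2 * (K * B)"
      unfolding norm_mult norm_power using m K by (intro add_mono mult_mono mult_left_mono Suc) auto
    also have "\<dots> = K * (1 + (norm m)\<^sup>2 * B)" by (simp add: algebra_simps)
    also have "1 + (norm m)\<^sup>2 * B = B"
      using m power_less_one_iff[of "norm m" 2] by (simp add: B_def field_simps)
    finally show ?case .
  qed
  define V where "V = (\<lambda>n. J n / m ^ n)"
  have V: "V \<longlonglongrightarrow> 1" unfolding V_def by (rule J)
  have JV: "J n = m ^ n * V n" for n using m(1) by (simp add: V_def)
  have eq: "m * J 0 = - (V N * s (Suc N)) - m\<^sup>2 * (V (Suc N) * s N)" for N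
  proof -
    have "J 0 = J 0 * X (Suc 0) - J (Suc 0) * X 0" by (simp add: X)
    also have "\<dots> = (- 1) ^ N * (J N * X (Suc N) - J (Suc N) * X N)"
      by (rule casoratian_const[OF J(1) X(1), symmetric])
    finally have J0: "J 0 = (- 1) ^ N * (m ^ N * V N * X (Suc N) - m ^ Suc N * V (Suc N) * X N)"
      unfolding JV[of N] JV[of "Suc N"] .
    show ?thesis
      unfolding J0 by (simp add: s_def power_minus[of m] algebra_simps power2_eq_square)
  qed
  have "(\<lambda>N. m * J 0 - m * D N) \<longlonglongrightarrow> 0"
  proof (rule Lim_null_comparison)
    show "\<forall>\<^sub>F N in sequentially. norm (m * J 0 - m * D N) \<le>
       norm (V N - 1) * (K * B) + (norm m)\<^sup>2 * (norm (V (Suc N) - 1) * (K * B))"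
    proof (intro always_eventually allI)
      fix N
      have "m * J 0 - m * D N = - ((V N - 1) * s (Suc N)) - m\<^sup>2 * ((V (Suc N) - 1) * s N)"
        unfolding eq[of N] Ds by (simp add: algebra_simps)
      then have "norm (m * J 0 - m * D N) \<le> norm ((V N - 1) * s (Suc N)) + norm (m\<^sup>2 * ((V (Suc N) - 1) * s N))"
        using norm_triangle_ineq4[of "- ((V N - 1) * s (Suc N))" "m\<^sup>2 * ((V (Suc N) - 1) * s N)"]
        by (simp only: norm_minus_cancel)
      also have "\<dots> \<le> norm (V N - 1) * (K * B) + (norm m)\<^sup>2 * (norm (V (Suc N) - 1) * (K * B))"
        unfolding norm_mult norm_power by (intro add_mono mult_left_mono s_le) auto
      finally show "norm (m * J 0 - m * D N) \<le> \<dots>" .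
    qed
    have "(\<lambda>N. norm (V N - 1) * (K * B) + (norm m)\<^sup>2 * (norm (V (Suc N) - 1) * (K * B))) \<longlonglongrightarrow>
       norm (1 - 1 :: complex) * (K * B) + (norm m)\<^sup>2 * (norm (1 - 1 :: complex) * (K * B))"
      by (intro tendsto_intros V LIMSEQ_Suc)
    then show "(\<lambda>N. norm (V N - 1) * (K * B) + (norm m)\<^sup>2 * (norm (V (Suc N) - 1) * (K * B))) \<longlonglongrightarrow> 0"
      by simp
  qed
  moreover have "(\<lambda>N. m * J 0 - m * D N) \<longlonglongrightarrow> m * J 0 - m * fredholm_det_I_plus a"
    unfolding D_def by (intro tendsto_intros lim)
  ultimately have "m * J 0 - m * fredholm_det_I_plus a = 0" by (rule LIMSEQ_unique[rotated])
  then show ?thesis using m(1) by simp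
qed

section \<open>Square-summable sequences and two-by-two matrices\<close>

text \<open>The product of the two roots is \<open>-1\<close>, and a root of modulus one would
  make \<open>l = cnj m - m\<close> imaginary.\<close>

lemma mu_plus_root:
  assumes l: "Re l > 0"
  shows "(mu_plus l)\<^sup>2 + l * mu_plus l - 1 = 0 \<and> cmod (mu_plus l) < 1"
  unfolding mu_plus_def
proof (rule theI', rule ex_ex1I)
  have not1: "cmod m \<noteq> 1" if m: "m\<^sup>2 + l * m - 1 = 0" for m
  proof
    assume m1: "cmod m = 1"
    then have "m \<noteq> 0" by auto
    then have "l = 1 / m - m" using m by (simp add: field_simps power2_eq_square)
    moreover have "Re (1 / m) = Re m"
      using m1 by (simp add: Re_divide cmod_power2[symmetric])
    ultimately show False using l by simp
  qed
  define m where "m = (- l + csqrt (l\<^sup>2 + 4)) / 2"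
  have m: "m\<^sup>2 + l * m - 1 = 0"
  proof -
    have s: "(csqrt (l\<^sup>2 + 4))\<^sup>2 = l\<^sup>2 + 4" by simp
    have "m\<^sup>2 + l * m - 1 = ((csqrt (l\<^sup>2 + 4))\<^sup>2 - l\<^sup>2 - 4) / 4"
      unfolding m_def power2_eq_square by (simp add: field_simps)
    then show ?thesis unfolding s by simp
  qed
  then have m0: "m \<noteq> 0" by auto
  have m': "(- 1 / m)\<^sup>2 + l * (- 1 / m) - 1 = 0"
    using m m0 by (simp add: field_simps power2_eq_square)
  have "cmod m < 1 \<or> cmod (- 1 / m) < 1"
    using not1[OF m] m0 by (simp add: norm_divide) linarith
  then show "\<exists>m. m\<^sup>2 + l * m - 1 = 0 \<and> cmod m < 1" using m m' by blast
next
  fix m n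
  assume m: "m\<^sup>2 + l * m - 1 = 0 \<and> cmod m < 1" and n: "n\<^sup>2 + l * n - 1 = 0 \<and> cmod n < 1"
  show "m = n"
  proof (rule ccontr)
    assume ne: "m \<noteq> n"
    have "(m - n) * (m + n + l) = (m\<^sup>2 + l * m - 1) - (n\<^sup>2 + l * n - 1)"
      by (simp add: algebra_simps power2_eq_square)
    with m n ne have "m + n + l = 0" by simp
    then have l': "l = - m - n" by (simp add: algebra_simps eq_neg_iff_add_eq_0)
    have "- (m * n) = 1" using m unfolding l' by (simp add: algebra_simps power2_eq_square)
    then have "cmod m * cmod n = 1" by (metis norm_mult norm_minus_cancel norm_one)
    moreover have "cmod m * cmod n < 1"
      using m n mult_strict_mono[of "cmod m" 1 "cmod n" 1] by simp
    ultimately show False by simp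
  qed
qed

lemma ell2_geometric:
  fixes x :: "nat \<Rightarrow> 'a::real_normed_vector"
  assumes t: "0 \<le> t" "t < 1" and x: "\<And>i. i \<ge> N \<Longrightarrow> norm (x i) \<le> K * t ^ i"
  shows "x \<in> ell2"
proof -
  have "summable (\<lambda>i. (norm (x i))\<^sup>2)"
  proof (rule summable_comparison_test'[of "\<lambda>i. K\<^sup>2 * (t\<^sup>2) ^ i" N])
    have "t\<^sup>2 < 1" using t by (simp add: power_less_one_iff)
    then show "summable (\<lambda>i. K\<^sup>2 * (t\<^sup>2) ^ i)" using t by (intro summable_mult summable_geometric) simp
    fix i assume "i \<ge> N"
    then have "(norm (x i))\<^sup>2 \<le> (K * t ^ i)\<^sup>2" by (intro power_mono x) auto
    then show "norm ((norm (x i))\<^sup>2) \<le> K\<^sup>2 * (t\<^sup>2) ^ i"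
      by (simp add: power_mult_distrib flip: power_mult) (simp add: mult.commute)
  qed
  then show ?thesis
    unfolding ell2_def by (simp add: summable_on_UNIV_nonneg_real_iff)
qed

lemma ell2_diff:
  assumes "x \<in> ell2" "y \<in> ell2"
  shows "(\<lambda>i. x i - y i) \<in> ell2"
proof -
  have le: "(norm (x i - y i))\<^sup>2 \<le> 2 * (norm (x i))\<^sup>2 + 2 * (norm (y i))\<^sup>2" for i
  proof -
    have "(norm (x i - y i))\<^sup>2 \<le> (norm (x i) + norm (y i))\<^sup>2"
      by (intro power_mono norm_triangle_ineq4) auto
    also have "\<dots> \<le> 2 * (norm (x i))\<^sup>2 + 2 * (norm (y i))\<^sup>2"
      using zero_le_power2[of "norm (x i) - norm (y i)"] by (simp add: power2_sum power2_diff)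
    finally show ?thesis .
  qed
  have "(\<lambda>i. 2 * (norm (x i))\<^sup>2 + 2 * (norm (y i))\<^sup>2) summable_on UNIV"
    using assms by (intro summable_on_add summable_on_cmult_right) (auto simp: ell2_def)
  then show ?thesis
    unfolding ell2_def using le by (auto intro: summable_on_comparison_test)
qed

lemma ell2_tendsto_0:
  fixes x :: "nat \<Rightarrow> 'a::real_normed_vector"
  assumes "x \<in> ell2"
  shows "x \<longlonglongrightarrow> 0"
proof -
  have "summable (\<lambda>i. (norm (x i))\<^sup>2)"
    using assms by (simp add: ell2_def summable_on_UNIV_nonneg_real_iff)
  then have "(\<lambda>i. (norm (x i))\<^sup>2) \<longlonglongrightarrow> 0" by (rule summable_LIMSEQ_zero)
  then have "(\<lambda>i. sqrt ((norm (x i))\<^sup>2)) \<longlonglongrightarrow> sqrt 0" by (intro tendsto_intros)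
  then show ?thesis by (simp add: tendsto_norm_zero_iff)
qed

text \<open>In the definitions a scalar multiple of a matrix is written as a product with
  \<open>mat c\<close>.\<close>

lemma mat_mult_component [simp]:
  fixes M :: "complex^2^2"
  shows "(mat c ** M) $ i $ j = c * M $ i $ j"
proof -
  have "(mat c ** M) $ i $ j = (\<Sum>k\<in>UNIV. (if i = k then c * M $ k $ j else 0))"
    by (simp add: matrix_matrix_mult_def mat_def if_distrib[of "\<lambda>x. x * _"] cong: if_cong)
  then show ?thesis by simp
qed

lemma Q_plus_nth [simp]: "Q_plus $ 1 $ 1 = 1" "Q_plus $ 1 $ 2 = 0" "Q_plus $ 2 $ i = 0"
  using exhaust_2[of i] by (auto simp: Q_plus_def)

lemma A_mat_nth [simp]: "A_mat l $ 1 $ 1 = - l" "A_mat l $ 1 $ 2 = 1" "A_mat l $ 2 $ 1 = 1" "A_mat l $ 2 $ 2 = 0"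
  by (simp_all add: A_mat_def)

lemma matrix_vector_2:
  fixes M :: "complex^2^2"
  shows "(M *v v) $ i = M $ i $ 1 * v $ 1 + M $ i $ 2 * v $ 2"
  by (simp add: matrix_vector_mult_def sum_2)

lemma matrix_matrix_2:
  fixes M N :: "complex^2^2"
  shows "(M ** N) $ i $ j = M $ i $ 1 * N $ 1 $ j + M $ i $ 2 * N $ 2 $ j"
  by (simp add: matrix_matrix_mult_def sum_2)

lemma range_Q_plus: "range ((*v) Q_plus) = {v. v $ 2 = 0}"
proof (intro equalityI subsetI)
  fix v :: "complex^2" assume "v \<in> {v. v $ 2 = 0}"
  then have "v = Q_plus *v v" by (simp add: vec_eq_iff forall_2 matrix_vector_2)
  then show "v \<in> range ((*v) Q_plus)" by blast
qed (auto simp: matrix_vector_2)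

text \<open>A projection is determined by its range and its kernel.\<close>

lemma proj_onto_parallel_eq:
  assumes P: "P ** P = P" "range ((*v) P) = X" "{v. P *v v = 0} = Y"
  shows "proj_onto_parallel X Y = P"
  unfolding proj_onto_parallel_def
proof (rule the_equality)
  fix P' assume P': "P' ** P' = P' \<and> range ((*v) P') = X \<and> {v. P' *v v = 0} = Y"
  have "P' *v v = P *v v" for v
  proof -
    have "P *v v \<in> range ((*v) P')" using P P' by auto
    then obtain u where u: "P *v v = P' *v u" by auto
    have "P *v (v - P *v v) = 0"
      by (simp add: matrix_vector_mult_diff_distrib matrix_vector_mul_assoc P)
    then have "P' *v (v - P *v v) = 0" using P P' by blast
    then have "P' *v v = P' *v (P *v v)" by (simp add: matrix_vector_mult_diff_distrib)
    also have "\<dots> = (P' ** P') *v u" unfolding u by (simp add: matrix_vector_mul_assoc)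
    also have "\<dots> = P *v v" using P' u by simp
    finally show ?thesis .
  qed
  then show "P' = P" by (simp add: matrix_eq)
qed (use P in auto)

lemma norm_vec2_le: "norm (v :: complex^2) \<le> norm (v $ 1) + norm (v $ 2)"
  unfolding norm_vec_def by (rule order_trans[OF L2_set_le_sum]) (simp_all add: sum_2)

lemma matrix_norm_tendsto_iff:
  fixes Y :: "nat \<Rightarrow> complex^2^2"
  shows "(\<lambda>n. norm (Y n)) \<longlonglongrightarrow> 0 \<longleftrightarrow> (\<forall>i j. (\<lambda>n. Y n $ i $ j) \<longlonglongrightarrow> 0)"
proof
  assume "(\<lambda>n. norm (Y n)) \<longlonglongrightarrow> 0"
  then have "Y \<longlonglongrightarrow> 0" by (rule tendsto_norm_zero_cancel)
  then have "(\<lambda>n. Y n $ i $ j) \<longlonglongrightarrow> (0 :: complex^2^2) $ i $ j" for i j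
    by (intro tendsto_vec_nth)
  then show "\<forall>i j. (\<lambda>n. Y n $ i $ j) \<longlonglongrightarrow> 0" by simp
next
  assume "\<forall>i j. (\<lambda>n. Y n $ i $ j) \<longlonglongrightarrow> 0"
  then have "Y \<longlonglongrightarrow> 0" by (intro vec_tendstoI) simp
  then show "(\<lambda>n. norm (Y n)) \<longlonglongrightarrow> 0" by (rule tendsto_norm_zero)
qed

lemma extensional_int_eqI:
  assumes "z \<in> extensional {-1..}" "w \<in> extensional {-1..}"
    and "\<And>k::nat. z (int k - 1) = w (int k - 1)"
  shows "z = w"
proof
  fix n :: int
  show "z n = w n"
  proof (cases "n \<ge> -1")
    case True
    then have "int (nat (n + 1)) - 1 = n" by simp
    with assms(3)[of "nat (n + 1)"] show ?thesis by simp
  next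
    case False
    then show ?thesis using assms(1,2) by (auto simp: extensional_def)
  qed
qed

section \<open>The Jost solution\<close>

text \<open>The right half line, with the spectral parameter as part of the data: the search for
  a positive zero instantiates the locale at every \<open>x > 0\<close>.\<close>

locale jost_setting =
  fixes r :: "int \<Rightarrow> real" and l :: complex
  assumes Re_l: "Re l > 0"
    and r_less_1: "\<And>n::nat. r (int n) < 1"
    and r_pos: "\<And>n::nat. n \<ge> 1 \<Longrightarrow> r (int n) > 0"
    and r_0: "r 0 < 0"
    and r_summable: "summable (\<lambda>n::nat. 1 - r (int n))"
begin

abbreviation "\<mu> \<equiv> mu_plus l"
abbreviation "coef \<equiv> \<lambda>n::nat. l / of_real (r (int n))"
definition "pert n = l * of_real ((1 - r (int n)) / r (int n))" for n :: nat

lemma mu: "norm \<mu> < 1" "\<mu> \<noteq> 0" "l = 1 / \<mu> - \<mu>"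
proof -
  have root: "\<mu>\<^sup>2 + l * \<mu> - 1 = 0" "cmod \<mu> < 1" using mu_plus_root[OF Re_l] by auto
  then show "norm \<mu> < 1" by simp
  show nz: "\<mu> \<noteq> 0" using root by auto
  show "l = 1 / \<mu> - \<mu>" using root nz by (simp add: field_simps power2_eq_square)
qed

lemma l_nonzero: "l \<noteq> 0" using Re_l by auto

lemma r_nonzero: "r (int n) \<noteq> 0"
  using r_pos[of n] r_0 by (cases n) auto

lemma coef_eq: "coef n = l + pert n"
  using r_nonzero[of n] by (simp add: pert_def field_simps)

lemma r_tendsto: "(\<lambda>n. r (int n)) \<longlonglongrightarrow> 1"
  using tendsto_diff[OF tendsto_const[of 1] summable_LIMSEQ_zero[OF r_summable]] by simp

text \<open>Since \<open>r n \<longlonglongrightarrow> 1\<close>, the perturbation is eventually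
  at most \<open>2 \<bar>l\<bar> (1 - r n)\<close>.\<close>

lemma pert_summable: "summable (\<lambda>n. norm (pert n))"
proof -
  have "eventually (\<lambda>n. r (int n) > 1 / 2) sequentially"
    by (rule order_tendstoD(1)[OF r_tendsto]) simp
  then have "eventually (\<lambda>n. norm (norm (pert n)) \<le> 2 * norm l * (1 - r (int n))) sequentially"
  proof eventually_elim
    case (elim n)
    then have "(1 - r (int n)) / r (int n) \<le> (1 - r (int n)) / (1 / 2)"
      using r_less_1[of n] by (intro divide_left_mono) auto
    then have "norm l * ((1 - r (int n)) / r (int n)) \<le> norm l * ((1 - r (int n)) / (1 / 2))"
      by (rule mult_left_mono) simp
    moreover have "norm (pert n) = norm l * ((1 - r (int n)) / r (int n))"
      unfolding pert_def norm_mult norm_of_real using elim r_less_1[of n] by simp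
    ultimately have "norm (pert n) \<le> 2 * norm l * (1 - r (int n))" by (simp add: mult_ac)
    then show ?case by simp
  qed
  then show ?thesis
    by (rule summable_comparison_test_ev) (intro summable_mult r_summable)
qed

definition "jost = (SOME X. three_term coef X \<and> (\<lambda>n. X n / \<mu> ^ n) \<longlonglongrightarrow> 1)"

lemma jost: "three_term coef jost" "(\<lambda>n. jost n / \<mu> ^ n) \<longlonglongrightarrow> 1"
proof -
  have "\<exists>X. three_term coef X \<and> (\<lambda>n. X n / \<mu> ^ n) \<longlonglongrightarrow> 1"
    using jost_exists[OF mu(1,2) pert_summable] unfolding coef_eq mu(3)[symmetric] .
  from someI_ex[OF this] show "three_term coef jost" "(\<lambda>n. jost n / \<mu> ^ n) \<longlonglongrightarrow> 1"
    by (simp_all add: jost_def)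
qed

lemma jost_eqI: "three_term coef X \<Longrightarrow> (\<lambda>n. X n / \<mu> ^ n) \<longlonglongrightarrow> 1 \<Longrightarrow> X = jost"
  by (rule jost_unique[OF mu(1,2) _ _ jost]) simp_all

lemma jost_tendsto_0: "jost \<longlonglongrightarrow> 0"
  by (rule power_times_convergent_tendsto_0[OF mu(1,2) jost(2)])

lemma jost_nontrivial: "\<not> (jost n = 0 \<and> jost (Suc n) = 0)"
proof
  assume z: "jost n = 0 \<and> jost (Suc n) = 0"
  have "jost (n + k) = 0 \<and> jost (Suc (n + k)) = 0" for k
    by (induction k) (use z in \<open>simp_all add: three_term_Suc_Suc[OF jost(1)]\<close>)
  then have "(\<lambda>k. jost (k + n) / \<mu> ^ (k + n)) = (\<lambda>k. 0)" by (simp add: add.commute)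
  moreover have "(\<lambda>k. jost (k + n) / \<mu> ^ (k + n)) \<longlonglongrightarrow> 1"
    by (rule LIMSEQ_ignore_initial_segment[OF jost(2)])
  ultimately show False by (simp add: LIMSEQ_const_iff)
qed

lemma b_c_seq: "b_seq r l n * c_seq r n = - pert n"
proof -
  have "complex_of_real (sqrt (1 - r (int n))) * complex_of_real (sqrt (1 - r (int n))) = of_real (1 - r (int n))"
    using r_less_1[of n] by (simp flip: of_real_mult)
  then show ?thesis by (simp add: b_seq_def c_seq_def pert_def)
qed

lemma c_seq_nonzero: "c_seq r n \<noteq> 0"
  using r_less_1[of n] by (simp add: c_seq_def)

section \<open>The two determinants\<close>

abbreviation "free \<equiv> initial_solution (\<lambda>_. l) 0 1"

definition "green j i = (- 1) ^ Suc j * \<mu> * free (Suc (min i j)) * \<mu> ^ max i j" for i j :: nat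

text \<open>As a function of \<open>i\<close> the kernel is a multiple of the regular solution
  up to the diagonal and of \<open>\<mu>\<^sup>i\<close> from the diagonal on; the factor
  \<open>(-1)\<^bsup>j+1\<^esup> \<mu>\<close> is the reciprocal of their Casoratian and
  normalizes the jump.\<close>

lemma green_equation:
  "(case i of 0 \<Rightarrow> 0 | Suc i' \<Rightarrow> green j i') - green j (Suc i) - l * green j i = (if i = j then 1 else 0)"
proof -
  define C where "C = (- 1) ^ Suc j * \<mu>"
  have le: "green j i = C * \<mu> ^ j * free (Suc i)" if "i \<le> j" for i
    using that by (simp add: green_def C_def min_absorb1 max_absorb2 mult_ac)
  have ge: "green j i = C * \<mu> ^ i * free (Suc j)" if "i \<ge> j" for i
    using that by (simp add: green_def C_def min_absorb2 max_absorb1 mult_ac)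
  have prev: "(case i of 0 \<Rightarrow> 0 | Suc i' \<Rightarrow> green j i') = C * \<mu> ^ j * free i" if "i \<le> j" for i
    using that le by (cases i) auto
  consider "i < j" | "i = j" | "i > j" by linarith
  then show ?thesis
  proof cases
    case 1
    then show ?thesis using prev[of i] le[of i] le[of "Suc i"] by (simp add: algebra_simps)
  next
    case 2
    have lm: "l + \<mu> = 1 / \<mu>" using mu(3) by (simp add: algebra_simps)
    have "C * \<mu> ^ j * free j - C * \<mu> ^ Suc j * free (Suc j) - l * (C * \<mu> ^ j * free (Suc j)) =
      C * \<mu> ^ j * (free j - (l + \<mu>) * free (Suc j))"
      by (simp add: algebra_simps)
    also have "\<dots> = - (C / \<mu>) * \<mu> ^ j * (free (Suc j) - \<mu> * free j)"
      unfolding lm using mu(2) by (simp add: field_simps)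
    also have "\<dots> = (- 1) ^ j * (\<mu> ^ j * (- 1 / \<mu>) ^ j)"
      unfolding free_solution_power[OF mu(2,3)] using mu(2) by (simp add: C_def)
    also have "\<mu> ^ j * (- 1 / \<mu>) ^ j = (- 1) ^ j"
      using mu(2) by (simp only: power_mult_distrib[symmetric]) simp
    finally show ?thesis
      using 2 prev[of j] le[of j] ge[of "Suc j"] by (simp flip: power_mult_distrib)
  next
    case 3
    then obtain i' where i: "i = Suc i'" "i' \<ge> j" by (cases i) auto
    have "C * \<mu> ^ i' * free (Suc j) - C * \<mu> ^ Suc (Suc i') * free (Suc j) - l * (C * \<mu> ^ Suc i' * free (Suc j)) =
      C * \<mu> ^ i' * free (Suc j) * (1 - \<mu> * \<mu> - l * \<mu>)"
      by (simp add: algebra_simps)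
    also have "1 - \<mu> * \<mu> - l * \<mu> = 0" using mu(2) by (subst mu(3)) (simp add: algebra_simps)
    finally show ?thesis using 3 i ge[of i'] ge[of i] ge[of "Suc i"] by simp
  qed
qed

lemma norm_green_le: "i \<ge> j \<Longrightarrow> norm (green j i) \<le> norm (\<mu> * free (Suc j)) * norm \<mu> ^ i"
  by (simp add: green_def norm_mult norm_power)

text \<open>This gives injectivity of both unperturbed operators: a square-summable element of a
  kernel is a decaying solution with vanishing left boundary value.\<close>

lemma free_decaying_eq_0:
  assumes "three_term (\<lambda>_. l) X" "X 0 = 0" "X \<longlonglongrightarrow> 0"
  shows "X n = 0"
proof -
  have "three_term (\<lambda>_. l) (\<lambda>n. \<mu> ^ n)"
    unfolding three_term_def
  proof
    fix n
    have "\<mu> ^ n - \<mu> ^ Suc (Suc n) = \<mu> ^ Suc n * (1 / \<mu> - \<mu>)"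
      using mu(2) by (simp add: algebra_simps)
    then show "\<mu> ^ n - \<mu> ^ Suc (Suc n) = l * \<mu> ^ Suc n" by (simp only: mu(3)[symmetric] mult.commute)
  qed
  from decaying_solutions_proportional[OF this assms(1) LIMSEQ_power_zero[OF mu(1)] assms(3)]
  have "X (Suc 0) = 0" using assms(2) by simp
  then show ?thesis using three_term_eq_0 assms by blast
qed

lemma shift_inj: "inj_on (\<lambda>x k. shift_right x k - shift_left x k - l * x k) ell2"
proof (rule inj_onI)
  fix x y :: "nat \<Rightarrow> complex"
  assume xy: "x \<in> ell2" "y \<in> ell2"
    and eq: "(\<lambda>k. shift_right x k - shift_left x k - l * x k) = (\<lambda>k. shift_right y k - shift_left y k - l * y k)"
  define X where "X = (\<lambda>k. case k of 0 \<Rightarrow> 0 | Suc k \<Rightarrow> x k - y k)"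
  have "X n - X (Suc (Suc n)) = l * X (Suc n)" for n
  proof -
    have "shift_right x n - shift_left x n - l * x n = shift_right y n - shift_left y n - l * y n"
      using eq by metis
    then show ?thesis
      by (cases n) (simp_all add: X_def shift_right_def shift_left_def algebra_simps)
  qed
  then have X: "three_term (\<lambda>_. l) X" by (simp add: three_term_def)
  have "(\<lambda>k. X (Suc k)) \<longlonglongrightarrow> 0"
    using ell2_tendsto_0[OF ell2_diff[OF xy]] by (simp add: X_def)
  then have "X \<longlonglongrightarrow> 0" by (rule LIMSEQ_imp_Suc)
  then have "X (Suc k) = 0" for k
    using free_decaying_eq_0[OF X, of "Suc k"] by (simp add: X_def)
  then show "x = y" by (simp add: X_def fun_eq_iff)
qed

lemma K_plus_entry:
  "K_plus r l (\<lambda>k. if k = j then 1 else 0) i = - (c_seq r i * (b_seq r l j * green j i))"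
proof -
  define x where "x = (\<lambda>i. b_seq r l j * green j i)"
  have "x \<in> ell2"
  proof (rule ell2_geometric)
    fix i assume "i \<ge> j"
    then have "norm (b_seq r l j) * norm (green j i) \<le> norm (b_seq r l j) * (norm (\<mu> * free (Suc j)) * norm \<mu> ^ i)"
      by (intro mult_left_mono norm_green_le) auto
    then show "norm (x i) \<le> (norm (b_seq r l j) * norm (\<mu> * free (Suc j))) * norm \<mu> ^ i"
      by (simp add: x_def norm_mult mult_ac)
  qed (use mu in auto)
  moreover have "(\<lambda>k. shift_right x k - shift_left x k - l * x k) =
     (\<lambda>k. b_seq r l k * (if k = j then 1 else 0))"
  proof
    fix k
    have "shift_right x k - shift_left x k - l * x k = b_seq r l j *
      ((case k of 0 \<Rightarrow> 0 | Suc i' \<Rightarrow> green j i') - green j (Suc k) - l * green j k)"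
      by (cases k) (simp_all add: x_def shift_right_def shift_left_def algebra_simps)
    then show "shift_right x k - shift_left x k - l * x k = b_seq r l k * (if k = j then 1 else 0)"
      unfolding green_equation by simp
  qed
  ultimately have "the_inv_into ell2 (\<lambda>x k. shift_right x k - shift_left x k - l * x k)
     (\<lambda>k. b_seq r l k * (if k = j then 1 else 0)) = x"
    by (intro the_inv_into_f_eq shift_inj) auto
  then show ?thesis by (simp add: K_plus_def x_def)
qed

text \<open>The two determinants only differ in how the index \<open>n\<close> is embedded into
  the index set of the matrix; the sign is that of \<open>I - K\<close> with \<open>K\<close>
  equal to minus the kernel.\<close>

lemma det_kernel_eq_jost:
  fixes \<iota> :: "nat \<Rightarrow> 'b"
  assumes "inj \<iota>" "\<And>x y. x \<notin> range \<iota> \<Longrightarrow> a x y = 0"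
    and ent: "\<And>i j. a (\<iota> i) (\<iota> j) = c_seq r i * (b_seq r l j * green j i)"
  shows "fredholm_det_I_plus a = jost 0"
proof (rule fredholm_det_semiseparable[OF mu(2,1,3) pert_summable assms(1,2)])
  show "a (\<iota> i) (\<iota> j) = c_seq r i * (b_seq r l j * (- 1) ^ Suc j * \<mu>) * free (Suc (min i j)) * \<mu> ^ max i j" for i j
    unfolding ent green_def by simp
  show "c_seq r i * (b_seq r l i * (- 1) ^ Suc i * \<mu>) = pert i * \<mu> * (- 1) ^ i" for i
  proof -
    have "c_seq r i * (b_seq r l i * (- 1) ^ Suc i * \<mu>) = - (b_seq r l i * c_seq r i) * \<mu> * (- 1) ^ i"
      by simp
    then show ?thesis unfolding b_c_seq by simp
  qed
  show "three_term (\<lambda>n. l + pert n) jost" using jost(1) unfolding coef_eq .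
qed (auto simp: c_seq_nonzero jost)

lemma det_K_plus_eq: "det_K_plus r l = jost 0"
  unfolding det_K_plus_def
  by (rule det_kernel_eq_jost[of id]) (simp_all add: K_plus_entry)

text \<open>The second component of an element of the kernel runs through a solution of the
  scalar recurrence; membership of the initial value in the range of \<open>Q_plus\<close> is
  the boundary condition.\<close>

lemma companion_inj: "inj_on (\<lambda>x k. shift_left x k - A_mat l *v x k) ell2_ranQ"
proof (rule inj_onI)
  fix x y :: "nat \<Rightarrow> complex^2"
  assume xy: "x \<in> ell2_ranQ" "y \<in> ell2_ranQ"
    and eq: "(\<lambda>k. shift_left x k - A_mat l *v x k) = (\<lambda>k. shift_left y k - A_mat l *v y k)"
  have eq: "(x (Suc n) - A_mat l *v x n) $ i = (y (Suc n) - A_mat l *v y n) $ i" for n i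
    using fun_cong[OF eq, of n] by (simp add: shift_left_def)
  define X where "X = (\<lambda>k. (x k - y k) $ 2)"
  have s2: "(x n - y n) $ 1 = X (Suc n)" for n
    using eq[of n 2] by (simp add: X_def matrix_vector_2 algebra_simps)
  have X2: "(x n - y n) $ 2 = X n" for n by (simp add: X_def)
  have "X n - X (Suc (Suc n)) = l * X (Suc n)" for n
  proof -
    have "(x (Suc n) - y (Suc n)) $ 1 + l * (x n - y n) $ 1 - (x n - y n) $ 2 = 0"
      using eq[of n 1] by (simp add: matrix_vector_2 algebra_simps)
    then show ?thesis unfolding s2 X2 by (simp add: algebra_simps)
  qed
  then have X: "three_term (\<lambda>_. l) X" by (simp add: three_term_def)
  have X0: "X 0 = 0" using xy by (simp add: ell2_ranQ_def range_Q_plus X_def)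
  have "(\<lambda>k. x k - y k) \<longlonglongrightarrow> 0"
    using xy by (intro ell2_tendsto_0 ell2_diff) (auto simp: ell2_ranQ_def)
  from tendsto_vec_nth[OF this, of 2] have "X \<longlonglongrightarrow> 0" by (simp add: X_def)
  then have X_0: "X k = 0" for k
    using free_decaying_eq_0[OF X X0] by blast
  show "x = y"
  proof
    fix n
    have "(x n - y n) $ 1 = 0" "(x n - y n) $ 2 = 0"
      using s2[of n] X_0[of "Suc n"] X_0[of n] by (simp_all add: X_def)
    then show "x n = y n" by (simp add: vec_eq_iff forall_2)
  qed
qed

text \<open>The preimage under the first-order system is the companion vector of minus the
  scalar solution; \<open>B_mat\<close> and \<open>C_mat\<close> keep the first coordinate
  only.\<close>

lemma T_plus_entry:
  "T_plus r l (\<lambda>k. if k = j then axis s 1 else 0) i $ s' =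
   (if s = 1 \<and> s' = 1 then - (c_seq r i * (b_seq r l j * green j i)) else 0)"
proof -
  define \<beta> where "\<beta> = (if s = 1 then b_seq r l j else 0)"
  define x :: "nat \<Rightarrow> complex^2" where
    "x = (\<lambda>i. vector [- (\<beta> * green j i), (case i of 0 \<Rightarrow> 0 | Suc i' \<Rightarrow> - (\<beta> * green j i'))])"
  have x1: "x i $ 1 = - (\<beta> * green j i)" for i by (simp add: x_def)
  have x2: "x i $ 2 = - (\<beta> * (case i of 0 \<Rightarrow> 0 | Suc i' \<Rightarrow> green j i'))" for i
    by (simp add: x_def split: nat.split)
  have "x \<in> ell2"
  proof (rule ell2_geometric)
    fix i assume i: "i \<ge> Suc j"
    define K where "K = norm \<beta> * norm (\<mu> * free (Suc j))"
    have g: "norm \<beta> * norm (green j n) \<le> K * norm \<mu> ^ n" if "n \<ge> j" for n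
    proof -
      have "norm \<beta> * norm (green j n) \<le> norm \<beta> * (norm (\<mu> * free (Suc j)) * norm \<mu> ^ n)"
        by (intro mult_left_mono norm_green_le that) auto
      then show ?thesis by (simp add: K_def mult_ac)
    qed
    obtain i' where i': "i = Suc i'" "i' \<ge> j" using i by (cases i) auto
    have "norm (x i) \<le> norm (x i $ 1) + norm (x i $ 2)" by (rule norm_vec2_le)
    also have "\<dots> \<le> K * norm \<mu> ^ i + K * norm \<mu> ^ i'"
      unfolding x1 x2 using g[of i] g[of i'] i i' by (simp add: norm_mult)
    also have "\<dots> = (K + K / norm \<mu>) * norm \<mu> ^ i"
      using mu(2) by (simp add: i' algebra_simps)
    finally show "norm (x i) \<le>
      (norm \<beta> * norm (\<mu> * free (Suc j)) + norm \<beta> * norm (\<mu> * free (Suc j)) / norm \<mu>) * norm \<mu> ^ i"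
      by (simp only: K_def)
  qed (use mu in auto)
  then have x: "x \<in> ell2_ranQ" by (simp add: ell2_ranQ_def range_Q_plus x2)
  have "(\<lambda>k. shift_left x k - A_mat l *v x k) =
     (\<lambda>k. B_mat r l k *v (if k = j then axis s 1 else 0))"
  proof
    fix k
    have "(shift_left x k - A_mat l *v x k) $ 1 = \<beta> *
      ((case k of 0 \<Rightarrow> 0 | Suc i' \<Rightarrow> green j i') - green j (Suc k) - l * green j k)"
      by (simp add: shift_left_def matrix_vector_2 x1 x2 algebra_simps)
    also have "\<dots> = (if k = j then \<beta> else 0)" unfolding green_equation by simp
    also have "\<dots> = (B_mat r l k *v (if k = j then axis s 1 else 0)) $ 1"
      by (simp add: matrix_vector_2 B_mat_def \<beta>_def axis_def)
    finally have 1: "(shift_left x k - A_mat l *v x k) $ 1 = (B_mat r l k *v (if k = j then axis s 1 else 0)) $ 1" .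
    have 2: "(shift_left x k - A_mat l *v x k) $ 2 = (B_mat r l k *v (if k = j then axis s 1 else 0)) $ 2"
      by (simp add: shift_left_def matrix_vector_2 x1 x2 B_mat_def)
    from 1 2 show "shift_left x k - A_mat l *v x k = B_mat r l k *v (if k = j then axis s 1 else 0)"
      by (simp add: vec_eq_iff forall_2)
  qed
  then have "the_inv_into ell2_ranQ (\<lambda>x k. shift_left x k - A_mat l *v x k)
     (\<lambda>k. B_mat r l k *v (if k = j then axis s 1 else 0)) = x"
    by (intro the_inv_into_f_eq companion_inj x)
  then have "T_plus r l (\<lambda>k. if k = j then axis s 1 else 0) i $ s' = (C_mat r i *v x i) $ s'"
    by (simp add: T_plus_def)
  also have "\<dots> = (if s = 1 \<and> s' = 1 then - (c_seq r i * (b_seq r l j * green j i)) else 0)"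
    using exhaust_2[of s'] by (auto simp: matrix_vector_2 C_mat_def x1 \<beta>_def)
  finally show ?thesis .
qed

lemma det_T_plus_eq: "det_T_plus r l = jost 0"
  unfolding det_T_plus_def
proof (rule det_kernel_eq_jost[of "\<lambda>n. (n, 1)"])
  fix x y :: "nat \<times> 2"
  assume "x \<notin> range (\<lambda>n. (n, 1))"
  then have "snd x \<noteq> 1" by (cases x) auto
  then show "(\<lambda>(i :: nat \<times> 2) (j :: nat \<times> 2).
     - (T_plus r l (\<lambda>k. if k = fst j then axis (snd j) 1 else 0) (fst i) $ snd i)) x y = 0"
    by (simp add: T_plus_entry)
qed (auto simp: T_plus_entry inj_on_def)

section \<open>The Evans function\<close>

lemma mu_sq: "1 + \<mu>\<^sup>2 \<noteq> 0"
proof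
  assume "1 + \<mu>\<^sup>2 = 0"
  then have "\<mu>\<^sup>2 = - 1" by (simp add: eq_neg_iff_add_eq_0 add.commute)
  then have "norm \<mu> ^ 2 = 1" by (metis norm_minus_cancel norm_one norm_power)
  then show False using mu(1) norm_ge_zero[of \<mu>] by (auto simp: power2_eq_1_iff)
qed

text \<open>The matrix \<open>A_mat l\<close> is symmetric with eigenvectors \<open>(\<mu>,
  1)\<close> and \<open>(1, -\<mu>)\<close>, so the spectral projection is the
  bilinear-orthogonal projection onto the first; its normalizing constant \<open>1 +
  \<mu>\<^sup>2\<close> is nonzero because \<open>\<bar>\<mu>\<bar> < 1\<close>.\<close>

lemma range_P_plus: "range ((*v) (P_plus l)) = {v. v $ 1 = \<mu> * v $ 2}"
proof -
  define N where "N = (A_mat l - mat \<mu>) ** (A_mat l - mat \<mu>)"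
  define d where "d = 1 + \<mu>\<^sup>2"
  have d: "d \<noteq> 0" using mu_sq by (simp add: d_def)
  \<comment> \<open>The projection onto \<open>(\<mu>, 1)\<close> along \<open>(1, -\<mu>)\<close>.\<close>
  define P :: "complex^2^2" where "P = vector [vector [\<mu>\<^sup>2 / d, \<mu> / d], vector [\<mu> / d, 1 / d]]"
  have P: "P $ 1 $ 1 = \<mu>\<^sup>2 / d" "P $ 1 $ 2 = \<mu> / d" "P $ 2 $ 1 = \<mu> / d" "P $ 2 $ 2 = 1 / d"
    by (simp_all add: P_def)
  have Pv: "(P *v v) $ 1 = \<mu> / d * (\<mu> * v $ 1 + v $ 2)" "(P *v v) $ 2 = 1 / d * (\<mu> * v $ 1 + v $ 2)" for v
    by (simp_all add: matrix_vector_2 P algebra_simps power2_eq_square)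
  have lm: "- l - \<mu> = - 1 / \<mu>" using mu(3) by (simp add: algebra_simps)
  have Am: "(A_mat l - mat \<mu>) $ 1 $ 1 = - 1 / \<mu>" "(A_mat l - mat \<mu>) $ 1 $ 2 = 1"
    "(A_mat l - mat \<mu>) $ 2 $ 1 = 1" "(A_mat l - mat \<mu>) $ 2 $ 2 = - \<mu>"
    by (simp_all add: mat_def lm)
  have Nv: "(N *v v) $ 1 = d / \<mu>\<^sup>2 * (v $ 1 - \<mu> * v $ 2)" "(N *v v) $ 2 = - \<mu> * (d / \<mu>\<^sup>2 * (v $ 1 - \<mu> * v $ 2))" for v
    unfolding N_def matrix_vector_2 matrix_matrix_2 Am using mu(2)
    by (simp_all add: d_def field_simps power2_eq_square)
  have "P_plus l = proj_onto_parallel {v. N *v v = 0} (range ((*v) N))"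
    by (simp add: P_plus_def spectral_proj_def N_def Let_def)
  also have "\<dots> = P"
  proof (rule proj_onto_parallel_eq)
    have "P *v (P *v v) = P *v v" for v
      using d by (simp add: vec_eq_iff forall_2 Pv field_simps) (simp add: d_def algebra_simps power2_eq_square)
    then show "P ** P = P" by (simp add: matrix_eq flip: matrix_vector_mul_assoc)
    show "range ((*v) P) = {v. N *v v = 0}"
    proof (intro equalityI subsetI)
      fix v assume "v \<in> {v. N *v v = 0}"
      then have "v $ 1 = \<mu> * v $ 2" using d mu(2) by (simp add: vec_eq_iff forall_2 Nv)
      then have "P *v v = v"
        using d by (simp add: vec_eq_iff forall_2 Pv field_simps) (simp add: d_def algebra_simps power2_eq_square)
      then show "v \<in> range ((*v) P)" by (metis rangeI)
    qed (auto simp: vec_eq_iff forall_2 Nv Pv)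
    show "{v. P *v v = 0} = range ((*v) N)"
    proof (intro equalityI subsetI)
      fix v assume "v \<in> {v. P *v v = 0}"
      then have v: "v $ 2 = - \<mu> * v $ 1"
        using d mu(2) by (simp add: vec_eq_iff forall_2 Pv eq_neg_iff_add_eq_0 add.commute)
      have "N *v ((\<mu>\<^sup>2 / d\<^sup>2) *s v) = v"
        using d mu(2) by (simp add: vec_eq_iff forall_2 Nv v field_simps)
          (simp add: d_def algebra_simps power2_eq_square)
      then show "v \<in> range ((*v) N)" by (metis rangeI)
    qed (auto simp: vec_eq_iff forall_2 Nv Pv)
  qed
  finally have "P_plus l = P" .
  moreover have "range ((*v) P) = {v. v $ 1 = \<mu> * v $ 2}"
  proof (intro equalityI subsetI)
    fix v :: "complex^2" assume "v \<in> {v. v $ 1 = \<mu> * v $ 2}"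
    then have "P *v v = v"
      using d by (simp add: vec_eq_iff forall_2 Pv field_simps) (simp add: d_def algebra_simps power2_eq_square)
    then show "v \<in> range ((*v) P)" by (metis rangeI)
  qed (auto simp: Pv)
  ultimately show ?thesis by simp
qed

lemma R_plus_nth: "R_plus l $ 1 $ 1 = 0" "R_plus l $ 1 $ 2 = \<mu>" "R_plus l $ 2 $ 1 = 0" "R_plus l $ 2 $ 2 = 1"
proof -
  define R :: "complex^2^2" where "R = vector [vector [0, \<mu>], vector [0, 1]]"
  have R: "R $ 1 $ 1 = 0" "R $ 1 $ 2 = \<mu>" "R $ 2 $ 1 = 0" "R $ 2 $ 2 = 1"
    by (simp_all add: R_def)
  have "R_plus l = R"
    unfolding R_plus_def range_P_plus range_Q_plus
  proof (rule proj_onto_parallel_eq)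
    show "R ** R = R" by (simp add: vec_eq_iff forall_2 matrix_matrix_2 R)
    show "range ((*v) R) = {v. v $ 1 = \<mu> * v $ 2}"
    proof (intro equalityI subsetI)
      fix v :: "complex^2" assume "v \<in> {v. v $ 1 = \<mu> * v $ 2}"
      then have "v = R *v v" by (simp add: vec_eq_iff forall_2 matrix_vector_2 R)
      then show "v \<in> range ((*v) R)" by blast
    qed (auto simp: matrix_vector_2 R)
    show "{v. R *v v = 0} = {v. v $ 2 = 0}"
      by (auto simp: vec_eq_iff forall_2 matrix_vector_2 R)
  qed
  with R show "R_plus l $ 1 $ 1 = 0" "R_plus l $ 1 $ 2 = \<mu>" "R_plus l $ 2 $ 1 = 0" "R_plus l $ 2 $ 2 = 1"
    by simp_all
qed

lemma A_power_R:
  "(matrix_power (A_mat l) n ** R_plus l) $ i $ j = (if j = 1 then 0 else if i = 1 then \<mu> ^ Suc n else \<mu> ^ n)"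
proof (induction n arbitrary: i)
  case 0
  show ?case using exhaust_2[of i] exhaust_2[of j] by (auto simp: matrix_power_def R_plus_nth)
next
  case (Suc n)
  have "matrix_power (A_mat l) (Suc n) ** R_plus l = A_mat l ** (matrix_power (A_mat l) n ** R_plus l)"
    by (simp add: matrix_power_def matrix_mul_assoc)
  moreover have "- (l * \<mu> ^ Suc n) + \<mu> ^ n = \<mu> ^ Suc (Suc n)"
    using mu(2) by (subst mu(3)) (simp add: algebra_simps)
  ultimately show ?case
    using exhaust_2[of i] exhaust_2[of j] by (auto simp: matrix_matrix_2[of "A_mat l"] Suc)
qed

lemma A_cross_nth: "A_cross r l n $ 1 $ 1 = - coef n" "A_cross r l n $ 1 $ 2 = 1"
  "A_cross r l n $ 2 $ 1 = 1" "A_cross r l n $ 2 $ 2 = 0"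
proof -
  have "- l + b_seq r l n * c_seq r n = - coef n" unfolding b_c_seq coef_eq by simp
  then show "A_cross r l n $ 1 $ 1 = - coef n" "A_cross r l n $ 1 $ 2 = 1"
    "A_cross r l n $ 2 $ 1 = 1" "A_cross r l n $ 2 $ 2 = 0"
    by (simp_all add: A_cross_def matrix_matrix_2[of "mat (b_seq r l n) ** Q_plus"] B_mat_def C_mat_def)
qed

text \<open>The normalization \<open>Y\<^sub>0 = Y\<^sub>0 R\<^sub>+\<close> says that the first
  column of \<open>Y\<^sub>0\<close>, hence of each \<open>Y\<^sub>n\<close>, is zero. The
  second column is the companion vector of a scalar solution, and its asymptotics are those that
  characterize \<open>jost\<close>.\<close>

lemma jost_matrix_eq:
  "jost_matrix r l = (\<lambda>n. vector [vector [0, jost (Suc n)], vector [0, jost n]])" (is "_ = ?Y")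
  unfolding jost_matrix_def
proof (rule the_equality)
  have Y: "?Y n $ 1 $ 1 = 0" "?Y n $ 1 $ 2 = jost (Suc n)" "?Y n $ 2 $ 1 = 0" "?Y n $ 2 $ 2 = jost n" for n
    by simp_all
  have step: "?Y (Suc n) = A_cross r l n ** ?Y n" for n
    using three_term_Suc_Suc[OF jost(1), of n]
    by (simp add: vec_eq_iff forall_2 matrix_matrix_2 A_cross_nth)
  have lim: "(\<lambda>n. norm (mat (\<mu> powi (- int n)) ** (?Y n - matrix_power (A_mat l) n ** R_plus l))) \<longlonglongrightarrow> 0"
  proof -
    have "(\<lambda>n. (mat (\<mu> powi (- int n)) ** (?Y n - matrix_power (A_mat l) n ** R_plus l)) $ 1 $ 2) =
      (\<lambda>n. \<mu> * (jost (Suc n) / \<mu> ^ Suc n - 1))"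
      using mu(2) by (simp add: fun_eq_iff A_power_R power_int_minus field_simps)
    moreover have "(\<lambda>n. \<mu> * (jost (Suc n) / \<mu> ^ Suc n - 1)) \<longlonglongrightarrow> \<mu> * (1 - 1)"
      by (intro tendsto_intros LIMSEQ_Suc[OF jost(2)])
    moreover have "(\<lambda>n. (mat (\<mu> powi (- int n)) ** (?Y n - matrix_power (A_mat l) n ** R_plus l)) $ 2 $ 2) =
      (\<lambda>n. jost n / \<mu> ^ n - 1)"
      using mu(2) by (simp add: A_power_R power_int_minus field_simps)
    moreover have "(\<lambda>n. jost n / \<mu> ^ n - 1) \<longlonglongrightarrow> 1 - 1"
      by (intro tendsto_intros jost(2))
    ultimately show ?thesis
      unfolding matrix_norm_tendsto_iff forall_2 by (simp add: A_power_R)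
  qed
  have "?Y 0 = ?Y 0 ** R_plus l"
    by (simp add: vec_eq_iff forall_2 matrix_matrix_2 R_plus_nth)
  with step lim show "(\<forall>n. ?Y (Suc n) = A_cross r l n ** ?Y n) \<and>
     (\<lambda>n. norm (mat (\<mu> powi (- int n)) ** (?Y n - matrix_power (A_mat l) n ** R_plus l))) \<longlonglongrightarrow> 0 \<and>
     ?Y 0 = ?Y 0 ** R_plus l" by blast
next
  fix Y :: "nat \<Rightarrow> complex^2^2"
  assume "(\<forall>n. Y (Suc n) = A_cross r l n ** Y n) \<and>
     (\<lambda>n. norm (mat (\<mu> powi (- int n)) ** (Y n - matrix_power (A_mat l) n ** R_plus l))) \<longlonglongrightarrow> 0 \<and>
     Y 0 = Y 0 ** R_plus l"
  then have step: "Y (Suc n) = A_cross r l n ** Y n"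
    and lim: "(\<lambda>n. (mat (\<mu> powi (- int n)) ** (Y n - matrix_power (A_mat l) n ** R_plus l)) $ i $ j) \<longlonglongrightarrow> 0"
    and Y0: "Y 0 = Y 0 ** R_plus l" for n i j
    unfolding matrix_norm_tendsto_iff by blast+
  have Y0_1: "Y 0 $ i $ 1 = 0" for i
    by (subst Y0) (simp add: matrix_matrix_2 R_plus_nth)
  have Y1: "Y n $ i $ 1 = 0" for n i
  proof (induction n arbitrary: i)
    case (Suc n)
    then show ?case by (simp add: step matrix_matrix_2)
  qed (rule Y0_1)
  define X where "X = (\<lambda>n. Y n $ 2 $ 2)"
  have Y12: "Y n $ 1 $ 2 = X (Suc n)" for n
    by (simp add: X_def step matrix_matrix_2 A_cross_nth)
  have "X n - X (Suc (Suc n)) = coef n * X (Suc n)" for n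
  proof -
    have "X (Suc (Suc n)) = Y (Suc n) $ 1 $ 2" by (simp add: Y12)
    also have "\<dots> = X n - coef n * X (Suc n)"
      unfolding step by (simp add: matrix_matrix_2 A_cross_nth Y12) (simp add: X_def)
    finally show ?thesis by simp
  qed
  then have X: "three_term coef X" by (simp add: three_term_def)
  have "(\<lambda>n. (mat (\<mu> powi (- int n)) ** (Y n - matrix_power (A_mat l) n ** R_plus l)) $ 2 $ 2) =
      (\<lambda>n. X n / \<mu> ^ n - 1)"
    using mu(2) by (simp add: A_power_R power_int_minus field_simps X_def)
  with lim[of 2 2] have "(\<lambda>n. X n / \<mu> ^ n - 1) \<longlonglongrightarrow> 0" by simp
  then have "(\<lambda>n. X n / \<mu> ^ n) \<longlonglongrightarrow> 1" by (simp add: LIM_zero_iff)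
  then have "X = jost" by (rule jost_eqI[OF X])
  then show "Y = ?Y"
    using Y1 Y12 by (simp add: fun_eq_iff vec_eq_iff forall_2) (simp add: X_def)
qed

lemma evans_plus_eq: "evans_plus r l = jost 0"
  by (simp add: evans_plus_def jost_matrix_eq R_minus_def det_2 R_plus_nth mat_def)

section \<open>The Jost function and the continued fraction\<close>

lemma solves_E_iff: "solves_E r l z \<longleftrightarrow> z \<in> extensional {-1..} \<and> three_term coef (\<lambda>k. z (int k - 1))"
proof -
  have "(z (int n - 1) - z (int n + 1) + b_seq r l n * c_seq r n * z (int n) = l * z (int n)) \<longleftrightarrow>
    (z (int n - 1) - z (int (Suc (Suc n)) - 1) = coef n * z (int (Suc n) - 1))" for n
    unfolding b_c_seq coef_eq by (auto simp: algebra_simps)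
  then show ?thesis by (simp add: solves_E_def three_term_def)
qed

text \<open>The factor \<open>1 / \<mu>\<close> comes from the index shift: \<open>z\<^sub>n
  \<mu>\<^bsup>-n\<^esup> \<longlonglongrightarrow> 1\<close> means \<open>X\<^sub>k
  \<mu>\<^bsup>-k\<^esup> \<longlonglongrightarrow> 1 / \<mu>\<close> for \<open>X\<^sub>k =
  z\<^bsub>k-1\<^esub>\<close>.\<close>

lemma jost_solution_eq: "jost_solution r l (int k - 1) = jost k / \<mu>"
proof -
  define w where "w = (\<lambda>n::int. if n \<ge> -1 then jost (nat (n + 1)) / \<mu> else undefined)"
  have w: "w (int k - 1) = jost k / \<mu>" for k by (simp add: w_def)
  have w': "w (int k) = jost (Suc k) / \<mu>" for k by (simp add: w_def nat_add_distrib)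
  have ext: "w \<in> extensional {-1..}" by (simp add: w_def extensional_def)
  have "jost_solution r l = w"
    unfolding jost_solution_def
  proof (rule the_equality)
    have "three_term coef (\<lambda>k. w (int k - 1))"
      unfolding w using three_term_cmult[OF jost(1), of "1 / \<mu>"] by simp
    moreover have "(\<lambda>n. \<mu> powi (- int n) * w (int n)) \<longlonglongrightarrow> 1"
    proof -
      have "(\<lambda>n. \<mu> powi (- int n) * w (int n)) = (\<lambda>n. jost (Suc n) / \<mu> ^ Suc n)"
        by (simp add: w' power_int_minus field_simps)
      then show ?thesis using LIMSEQ_Suc[OF jost(2)] by simp
    qed
    ultimately show "solves_E r l w \<and> (\<lambda>n. \<mu> powi (- int n) * w (int n)) \<longlonglongrightarrow> 1"
      using ext by (simp add: solves_E_iff)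
  next
    fix z assume z: "solves_E r l z \<and> (\<lambda>n::nat. \<mu> powi (- int n) * z (int n)) \<longlonglongrightarrow> 1"
    define X where "X = (\<lambda>k. \<mu> * z (int k - 1))"
    have "three_term coef X" unfolding X_def using z by (intro three_term_cmult) (simp add: solves_E_iff)
    moreover have "(\<lambda>n. X (Suc n) / \<mu> ^ Suc n) \<longlonglongrightarrow> 1"
    proof -
      have "(\<lambda>n. X (Suc n) / \<mu> ^ Suc n) = (\<lambda>n. \<mu> powi (- int n) * z (int n))"
        using mu(2) by (simp add: X_def power_int_minus field_simps)
      then show ?thesis using z by simp
    qed
    then have "(\<lambda>n. X n / \<mu> ^ n) \<longlonglongrightarrow> 1" by (rule LIMSEQ_imp_Suc)
    ultimately have "X = jost" by (rule jost_eqI)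
    then have "\<mu> * z (int k - 1) = jost k" for k
      by (auto simp: X_def dest: fun_cong)
    then have "z (int k - 1) = w (int k - 1)" for k
      using mu(2) unfolding w by (simp add: eq_divide_eq mult.commute)
    then show "z = w" using z ext by (intro extensional_int_eqI) (auto simp: solves_E_iff)
  qed
  then show ?thesis by (simp add: w)
qed

lemma regular_solution_initial: "regular_solution r l (-1) = 0" "regular_solution r l 0 = 1"
proof -
  define w where "w = (\<lambda>n::int. if n \<ge> -1 then initial_solution coef 0 1 (nat (n + 1)) else undefined)"
  have w: "w (int k - 1) = initial_solution coef 0 1 k" for k by (simp add: w_def)
  have ext: "w \<in> extensional {-1..}" by (simp add: w_def extensional_def)
  have "\<exists>!z. solves_E r l z \<and> z (-1) = 0 \<and> z 0 = 1"
  proof (rule ex1I)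
    show "solves_E r l w \<and> w (-1) = 0 \<and> w 0 = 1"
      using ext by (simp add: solves_E_iff w three_term_initial_solution) (simp add: w_def)
    fix z assume z: "solves_E r l z \<and> z (-1) = 0 \<and> z 0 = 1"
    have "(\<lambda>k. z (int k - 1)) = initial_solution coef 0 1"
      by (rule three_term_unique[OF _ three_term_initial_solution]) (use z in \<open>auto simp: solves_E_iff\<close>)
    then have "z (int k - 1) = w (int k - 1)" for k unfolding w by (rule fun_cong)
    then show "z = w" using z ext by (intro extensional_int_eqI) (auto simp: solves_E_iff)
  qed
  from theI'[OF this] show "regular_solution r l (-1) = 0" "regular_solution r l 0 = 1"
    by (simp_all add: regular_solution_def)
qed

lemma jost_function_eq: "jost_function r l = jost 0"
  using jost_solution_eq[of 0] mu(2)
  by (simp add: jost_function_def wronskian_def regular_solution_initial)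

lemma Re_coef_ge: "n \<ge> 1 \<Longrightarrow> Re l \<le> Re (coef n)"
  using r_pos[of n] r_less_1[of n] Re_l by (simp add: le_divide_eq)

lemma cf_tail_converges:
  assumes "m \<ge> 1"
  shows "jost m \<noteq> 0" "cf_approx coef m \<longlonglongrightarrow> jost (Suc m) / jost m"
proof -
  have "Re l \<le> Re (coef k)" if "k \<ge> m" for k
    using Re_coef_ge that assms by (meson order_trans)
  note c = cf_converges[where a = coef and X = jost and m = m,
      OF jost(1) jost_tendsto_0 Re_l this jost_nontrivial]
  show "jost m \<noteq> 0" by (rule c(1))
  show "cf_approx coef m \<longlonglongrightarrow> jost (Suc m) / jost m" by (rule c(2))
qed

lemma g_plus_eq: "g_plus r l = jost 2 / jost 1"
  using limI[OF cf_tail_converges(2)[of 1]] by (simp add: g_plus_def numeral_2_eq_2)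

lemma G_plus_eq: "G_plus r l = jost 0"
proof -
  have "G_plus r l = jost 1 * (jost 2 / jost 1 + coef 0)"
    using jost_solution_eq[of 1] mu(2) by (simp add: G_plus_def g_plus_eq)
  also have "\<dots> = jost 2 + coef 0 * jost 1"
    using cf_tail_converges(1)[of 1] by (simp add: algebra_simps)
  also have "\<dots> = jost 0"
    using three_termD[OF jost(1), of 0] by (simp add: numeral_2_eq_2 algebra_simps)
  finally show ?thesis .
qed

end

section \<open>Eigenvalues of the operator on the line\<close>

lemma ell2_cmult:
  fixes w :: "'i \<Rightarrow> complex"
  assumes "w \<in> ell2"
  shows "(\<lambda>i. c * w i) \<in> ell2"
  using summable_on_cmult_right[of "\<lambda>i. (norm (w i))\<^sup>2" UNIV "(norm c)\<^sup>2"] assms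
  by (simp add: ell2_def norm_mult power_mult_distrib)

lemma ell2_reindex_inj:
  assumes w: "w \<in> ell2" and f: "inj f"
  shows "(\<lambda>k. w (f k)) \<in> ell2"
proof -
  have "(\<lambda>i. (norm (w i))\<^sup>2) summable_on range f"
    using w by (auto simp: ell2_def intro: summable_on_subset_banach)
  then show ?thesis
    using summable_on_reindex[OF f, of "\<lambda>i. (norm (w i))\<^sup>2"] by (simp add: ell2_def o_def)
qed

lemma ell2_extend_by_zero:
  assumes f: "inj f" and w: "(\<lambda>k. w (f k)) \<in> ell2"
    and fin: "finite F" and z: "\<And>i. i \<notin> range f \<union> F \<Longrightarrow> w i = 0"
  shows "w \<in> ell2"
proof -
  have "(\<lambda>i. (norm (w i))\<^sup>2) summable_on range f"
    using summable_on_reindex[OF f, of "\<lambda>i. (norm (w i))\<^sup>2"] w by (simp add: ell2_def o_def)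
  then have "(\<lambda>i. (norm (w i))\<^sup>2) summable_on range f \<union> (F - range f)"
    using fin by (intro summable_on_Un_disjoint[OF _ summable_on_finite]) auto
  moreover have "(\<lambda>i. (norm (w i))\<^sup>2) summable_on UNIV \<longleftrightarrow>
    (\<lambda>i. (norm (w i))\<^sup>2) summable_on range f \<union> (F - range f)"
    by (rule summable_on_cong_neutral) (use z in auto)
  ultimately show ?thesis by (simp add: ell2_def)
qed

text \<open>The quantity \<open>Re (cnj (Y\<^sub>k) Y\<^bsub>k+1\<^esub>)\<close> increases by
  \<open>Re (a\<^sub>k) \<bar>Y\<^bsub>k+1\<^esub>\<bar>\<^sup>2\<close> in each step. It starts
  at zero and tends to zero, so every increment is zero.\<close>

lemma growing_solution_trivial:
  fixes Y :: "nat \<Rightarrow> complex"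
  assumes rec: "\<And>k. Y (Suc (Suc k)) = Y k + a k * Y (Suc k)" and a: "\<And>k. Re (a k) > 0"
    and Y0: "Y 0 = 0" and lim: "Y \<longlonglongrightarrow> 0"
  shows "Y k = 0"
proof -
  define s where "s = (\<lambda>k. Re (cnj (Y k) * Y (Suc k)))"
  have s_Suc: "s (Suc k) = s k + Re (a k) * (norm (Y (Suc k)))\<^sup>2" for k
    unfolding s_def rec cmod_power2 by (simp add: power2_eq_square algebra_simps)
  have "incseq s" using a by (intro incseq_SucI) (simp add: s_Suc less_imp_le)
  moreover have "s \<longlonglongrightarrow> Re (cnj 0 * 0)"
    unfolding s_def by (intro tendsto_intros lim LIMSEQ_Suc)
  then have "s \<longlonglongrightarrow> 0" by simp
  ultimately have "s k \<le> 0" for k by (rule incseq_le)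
  moreover have "s k \<ge> s 0" for k using \<open>incseq s\<close> by (simp add: incseqD)
  ultimately have s: "s k = 0" for k
    by (metis Y0 antisym complex_cnj_zero mult_zero_left s_def zero_complex.sel(1))
  show ?thesis
  proof (cases k)
    case (Suc j)
    have "Re (a j) * (norm (Y (Suc j)))\<^sup>2 = 0" using s_Suc[of j] s by simp
    then show ?thesis using a[of j] Suc by auto
  qed (use Y0 in simp)
qed

text \<open>Under the normalization of \<open>\<alpha>\<close> this is the operator
  \<open>L\<^sub>q\<close>.\<close>

definition weighted_shift_op :: "(int \<Rightarrow> real) \<Rightarrow> (int \<Rightarrow> complex) \<Rightarrow> int \<Rightarrow> complex" where
  "weighted_shift_op r w = (\<lambda>n. of_real (r (n - 1)) * w (n - 1) - of_real (r (n + 1)) * w (n + 1))"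

locale two_sided_setting = jost_setting +
  assumes r_minus_1: "r (-1) = 0" and r_left: "\<And>n. n \<le> -2 \<Longrightarrow> 0 < r n" "\<And>n. n \<le> -2 \<Longrightarrow> r n < 1"
begin

text \<open>If \<open>jost 0 \<noteq> 0\<close>, then a decaying solution with \<open>X\<^sub>0
  = 0\<close> vanishes, so \<open>w\<close> is zero on the right half line; it is zero on the
  left one by the energy identity, and then the equation at \<open>-1\<close> gives \<open>w
  (-1) = 0\<close>.\<close>

lemma eigenvalue_imp_jost_0:
  assumes "is_eigenvalue (weighted_shift_op r) l"
  shows "jost 0 = 0"
proof (rule ccontr)
  assume J0: "jost 0 \<noteq> 0"
  obtain w where w: "w \<in> ell2" "w \<noteq> (\<lambda>_. 0)" and eq: "weighted_shift_op r w = (\<lambda>i. l * w i)"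
    using assms by (auto simp: is_eigenvalue_def op_domain_def)
  define z where "z = (\<lambda>n. of_real (r n) * w n)"
  have zeq: "z (n - 1) - z (n + 1) = l * w n" for n
    using fun_cong[OF eq, of n] by (simp add: weighted_shift_op_def z_def)
  define X where "X = (\<lambda>k. z (int k - 1))"
  have "X k - X (Suc (Suc k)) = coef k * X (Suc k)" for k
    using zeq[of "int k"] r_nonzero[of k] by (simp add: X_def z_def field_simps)
  then have X: "three_term coef X" by (simp add: three_term_def)
  have X0: "X 0 = 0" by (simp add: X_def z_def r_minus_1)
  have "(\<lambda>k. w (int k)) \<longlonglongrightarrow> 0"
    by (intro ell2_tendsto_0 ell2_reindex_inj[OF w(1)]) (simp add: inj_on_def)
  then have "(\<lambda>k. of_real (r (int k)) * w (int k)) \<longlonglongrightarrow> of_real 1 * 0"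
    by (intro tendsto_intros r_tendsto)
  then have "(\<lambda>k. X (Suc k)) \<longlonglongrightarrow> 0" by (simp add: X_def z_def)
  then have "X \<longlonglongrightarrow> 0" by (rule LIMSEQ_imp_Suc)
  from decaying_solutions_proportional[OF X jost(1) this jost_tendsto_0]
  have "X (Suc 0) = 0" using X0 J0 by simp
  then have Xz: "X k = 0" for k by (rule three_term_eq_0[OF X X0])
  have pos: "w n = 0" if "n \<ge> 0" for n
  proof -
    define k where "k = nat n"
    have k: "n = int k" using that by (simp add: k_def)
    have "X (Suc k) = of_real (r n) * w n" by (simp add: X_def z_def k)
    then show ?thesis using Xz r_nonzero[of k] k by simp
  qed
  define Y where "Y = (\<lambda>k::nat. z (- 1 - int k))"
  have "Y (Suc (Suc k)) = Y k + l / of_real (r (- 2 - int k)) * Y (Suc k)" for k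
  proof -
    define n where "n = - 2 - int k"
    have Y: "Y (Suc (Suc k)) = z (n - 1)" "Y (Suc k) = z n" "Y k = z (n + 1)"
      unfolding Y_def n_def by (rule arg_cong[of _ _ z], simp)+
    have "r n \<noteq> 0" using r_left(1)[of n] by (simp add: n_def)
    then have "l * w n = l / of_real (r n) * z n" by (simp add: z_def)
    with zeq[of n] show "Y (Suc (Suc k)) = Y k + l / of_real (r n) * Y (Suc k)"
      unfolding Y by (simp add: algebra_simps)
  qed
  moreover have "Re (l / of_real (r (- 2 - int k))) > 0" for k :: nat
    using r_left(1)[of "- 2 - int k"] Re_l by simp
  moreover have "Y 0 = 0" by (simp add: Y_def z_def r_minus_1)
  moreover have "Y \<longlonglongrightarrow> 0"
  proof -
    have lim: "(\<lambda>k. w (- 1 - int (Suc k))) \<longlonglongrightarrow> 0"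
      by (intro ell2_tendsto_0 ell2_reindex_inj[OF w(1)]) (simp add: inj_on_def)
    have "(\<lambda>k. Y (Suc k)) \<longlonglongrightarrow> 0"
    proof (rule Lim_null_comparison[OF always_eventually tendsto_norm_zero[OF lim]], rule allI)
      fix k
      show "norm (Y (Suc k)) \<le> norm (w (- 1 - int (Suc k)))"
        using r_left[of "- 1 - int (Suc k)"] by (simp add: Y_def z_def norm_mult mult_left_le_one_le)
    qed
    then show ?thesis by (rule LIMSEQ_imp_Suc)
  qed
  ultimately have Y: "Y k = 0" for k
    by (rule growing_solution_trivial[where a = "\<lambda>k. l / of_real (r (- 2 - int k))"])
  have neg: "w n = 0" if "n \<le> -2" for n
  proof -
    have "Y (nat (- 1 - n)) = of_real (r n) * w n" using that by (simp add: Y_def z_def)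
    then show ?thesis using Y r_left(1)[OF that] by simp
  qed
  have "w (-1) = 0" using zeq[of "-1"] pos[of 0] neg[of "-2"] l_nonzero by (simp add: z_def)
  have "w n = 0" for n
  proof -
    consider "n \<ge> 0" | "n \<le> -2" | "n = -1" by linarith
    then show ?thesis using pos neg \<open>w (-1) = 0\<close> by cases auto
  qed
  with w(2) show False by auto
qed

text \<open>The entry at \<open>-1\<close> is invisible to the other entries since \<open>r (-1)
  = 0\<close>; it is determined by the equation at \<open>-1\<close>.\<close>

lemma jost_0_imp_eigenvalue:
  assumes J0: "jost 0 = 0"
  shows "is_eigenvalue (weighted_shift_op r) l"
proof -
  define w where "w = (\<lambda>n::int. if n \<ge> 0 then jost (nat n + 1) / of_real (r n)
    else if n = -1 then - jost 1 / l else 0)"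
  have w: "w (int k) = jost (Suc k) / of_real (r (int k))" for k by (simp add: w_def)
  have z: "of_real (r n) * w n = (if n \<ge> 0 then jost (nat n + 1) else 0)" for n
    using r_nonzero[of "nat n"] r_minus_1 by (auto simp: w_def)
  have eq: "weighted_shift_op r w = (\<lambda>n. l * w n)"
  proof
    fix n :: int
    consider "n \<ge> 1" | "n = 0" | "n = -1" | "n \<le> -2" by linarith
    then show "weighted_shift_op r w n = l * w n"
    proof cases
      case 1
      define k where "k = nat (n - 1)"
      have k: "n = int (Suc k)" using 1 by (simp add: k_def)
      show ?thesis
        unfolding weighted_shift_op_def z
        using three_termD[OF jost(1), of "Suc k"] by (simp add: k w[of "Suc k", simplified] nat_add_distrib)
    next
      case 2
      then show ?thesis
        unfolding weighted_shift_op_def z using three_termD[OF jost(1), of 0] J0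
        by (simp add: w[of 0, simplified] numeral_2_eq_2)
    next
      case 3
      then show ?thesis
        unfolding weighted_shift_op_def z using l_nonzero by (simp add: w_def)
    next
      case 4
      then show ?thesis
        unfolding weighted_shift_op_def z by (simp add: w_def)
    qed
  qed
  have "(\<lambda>k. w (int k)) \<in> ell2"
  proof -
    have "(\<lambda>n. \<mu> * (jost (Suc n) / \<mu> ^ Suc n) / of_real (r (int n))) \<longlonglongrightarrow> \<mu> * 1 / of_real 1"
      by (intro tendsto_intros LIMSEQ_Suc[OF jost(2)] r_tendsto) simp
    then have "Bseq (\<lambda>n. \<mu> * (jost (Suc n) / \<mu> ^ Suc n) / of_real (r (int n)))"
      by (intro convergent_imp_Bseq convergentI)
    then obtain K where K: "\<And>n. norm (\<mu> * (jost (Suc n) / \<mu> ^ Suc n) / of_real (r (int n))) \<le> K"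
      by (auto simp: Bseq_def)
    show ?thesis
    proof (rule ell2_geometric[of "norm \<mu>"])
      fix n :: nat
      have "w (int n) = (\<mu> * (jost (Suc n) / \<mu> ^ Suc n) / of_real (r (int n))) * \<mu> ^ n"
        using mu(2) by (simp add: w)
      then have "norm (w (int n)) = norm (\<mu> * (jost (Suc n) / \<mu> ^ Suc n) / of_real (r (int n))) * norm \<mu> ^ n"
        by (metis norm_mult norm_power)
      then show "norm (w (int n)) \<le> K * norm \<mu> ^ n"
        using mult_right_mono[OF K[of n], of "norm \<mu> ^ n"] by simp
    qed (use mu in auto)
  qed
  then have ell2: "w \<in> ell2"
  proof (rule ell2_extend_by_zero[of int _ "{-1}", rotated])
    fix i assume "i \<notin> range int \<union> {- 1}"
    moreover have "i \<in> range int" if "i \<ge> 0" using rangeI[of int "nat i"] that by simp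
    ultimately have "i < -1" by force
    then show "w i = 0" by (simp add: w_def)
  qed (auto simp: inj_on_def)
  have "w \<noteq> (\<lambda>_. 0)"
  proof
    assume "w = (\<lambda>_. 0)"
    then have "w (-1) = 0" by simp
    then have "jost 1 = 0" using l_nonzero by (simp add: w_def)
    then show False using jost_nontrivial[of 0] J0 by simp
  qed
  then show ?thesis
    unfolding is_eigenvalue_def op_domain_def using ell2 ell2_cmult[OF ell2] eq by auto
qed

lemma eigenvalue_iff: "is_eigenvalue (weighted_shift_op r) l \<longleftrightarrow> jost 0 = 0"
  using eigenvalue_imp_jost_0 jost_0_imp_eigenvalue by blast

end

section \<open>A positive zero\<close>

fun cf_real :: "(nat \<Rightarrow> real) \<Rightarrow> nat \<Rightarrow> nat \<Rightarrow> real" where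
  "cf_real a m 0 = 0"
| "cf_real a m (Suc N) = 1 / (a m + cf_real a (Suc m) N)"

lemma cf_approx_of_real: "cf_approx (\<lambda>k. of_real (a k)) m N = of_real (cf_real a m N)"
  by (induction N arbitrary: m) auto

lemma cf_real_nonneg:
  assumes "\<And>k. k \<ge> m \<Longrightarrow> a k > 0"
  shows "cf_real a m N \<ge> 0"
  using assms
proof (induction N arbitrary: m)
  case (Suc N)
  have "a m > 0" "cf_real a (Suc m) N \<ge> 0" using Suc by auto
  then show ?case by simp
qed simp

text \<open>Each level of the fraction reverses the order of positive tails, and the innermost
  tail is replaced by zero, which is too small.\<close>

lemma cf_real_bracket:
  assumes a: "\<And>k. k \<ge> m \<Longrightarrow> a k > 0" and u: "\<And>k. k \<ge> m \<Longrightarrow> cf_real a k \<longlonglongrightarrow> u k"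
  shows "(even N \<longrightarrow> cf_real a m N \<le> u m) \<and> (odd N \<longrightarrow> u m \<le> cf_real a m N)"
  using assms
proof (induction N arbitrary: m)
  case 0
  have "cf_real a m N \<ge> 0" for N by (rule cf_real_nonneg) (use 0 in auto)
  then have "u m \<ge> 0" using 0(2)[of m] by (intro LIMSEQ_le_const[of "cf_real a m"]) auto
  then show ?case by simp
next
  case (Suc N)
  have am: "a m > 0" using Suc.prems by simp
  have nn: "cf_real a (Suc m) N \<ge> 0" for N by (rule cf_real_nonneg) (use Suc.prems in auto)
  have lim: "cf_real a (Suc m) \<longlonglongrightarrow> u (Suc m)" using Suc.prems by simp
  then have u0: "u (Suc m) \<ge> 0" using nn by (intro LIMSEQ_le_const[of "cf_real a (Suc m)"]) auto
  have "(\<lambda>N. 1 / (a m + cf_real a (Suc m) N)) \<longlonglongrightarrow> 1 / (a m + u (Suc m))"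
    using am u0 by (intro tendsto_intros lim) auto
  then have "(\<lambda>N. cf_real a m (Suc N)) \<longlonglongrightarrow> 1 / (a m + u (Suc m))" by simp
  then have "cf_real a m \<longlonglongrightarrow> 1 / (a m + u (Suc m))" by (rule LIMSEQ_imp_Suc)
  then have um: "u m = 1 / (a m + u (Suc m))" using Suc.prems(2)[of m] LIMSEQ_unique by blast
  have IH: "(even N \<longrightarrow> cf_real a (Suc m) N \<le> u (Suc m)) \<and> (odd N \<longrightarrow> u (Suc m) \<le> cf_real a (Suc m) N)"
    by (rule Suc.IH) (use Suc.prems in auto)
  show ?case unfolding um using IH am u0 nn[of N] by (auto intro!: divide_left_mono mult_pos_pos add_pos_nonneg)
qed

lemma continuous_cf_real:
  assumes "\<And>k x. k \<ge> m \<Longrightarrow> x > 0 \<Longrightarrow> a x k > 0" and "\<And>k. k \<ge> m \<Longrightarrow> continuous_on {0<..} (\<lambda>x::real. a x k)"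
  shows "continuous_on {0<..} (\<lambda>x. cf_real (a x) m N)"
  using assms
proof (induction N arbitrary: m)
  case (Suc N)
  have "a x m + cf_real (a x) (Suc m) N \<noteq> 0" if "x > 0" for x
  proof -
    have "cf_real (a x) (Suc m) N \<ge> 0" by (rule cf_real_nonneg) (use Suc.prems that in auto)
    then show ?thesis using Suc.prems(1)[of m x] that by simp
  qed
  moreover have "continuous_on {0<..} (\<lambda>x. cf_real (a x) (Suc m) N)"
    by (rule Suc.IH) (use Suc.prems in auto)
  ultimately show ?case
    unfolding cf_real.simps using Suc.prems(2)[of m] by (intro continuous_intros) auto
qed simp

text \<open>As long as the value stays small, two levels of the fraction raise a lower bound
  \<open>s\<close> of the tail to at least \<open>s + x / 2\<close>: the inner level turns
  \<open>s\<close> into at most \<open>1 / (x + s)\<close>, and the outer one loses only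
  \<open>O(x (x + s)\<^sup>2)\<close>. So the slope at \<open>x = 0\<close> of the approximants
  is unbounded in \<open>j\<close>.\<close>

lemma cf_real_lower:
  assumes x: "x > 0" and A: "A > 0" and a: "\<And>k. k \<ge> m \<Longrightarrow> x \<le> a k" "\<And>k. k \<ge> m \<Longrightarrow> a k \<le> A * x"
    and small: "A * (x * (real j / 2 + 1))\<^sup>2 \<le> 1 / 2"
  shows "real j * x / 2 \<le> cf_real a m (2 * j)"
  using a small
proof (induction j arbitrary: m)
  case (Suc j)
  define s where "s = real j * x / 2"
  have s0: "s \<ge> 0" using x by (simp add: s_def)
  have "x * (real j / 2 + 1) \<le> x * (real (Suc j) / 2 + 1)" using x by simp
  then have "A * (x * (real j / 2 + 1))\<^sup>2 \<le> A * (x * (real (Suc j) / 2 + 1))\<^sup>2"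
    using A x by (intro mult_left_mono power_mono) auto
  then have sm: "A * (x * (real j / 2 + 1))\<^sup>2 \<le> 1 / 2" using Suc.prems(3) by linarith
  have IH: "s \<le> cf_real a (Suc (Suc m)) (2 * j)"
    unfolding s_def by (rule Suc.IH) (use Suc.prems sm in auto)
  have sx: "A * (x + s)\<^sup>2 \<le> 1 / 2"
    using sm by (simp add: s_def algebra_simps)
  have "cf_real a m (2 * Suc j) = 1 / (a m + 1 / (a (Suc m) + cf_real a (Suc (Suc m)) (2 * j)))"
    by simp
  also have "\<dots> \<ge> 1 / (A * x + 1 / (x + s))"
  proof (rule divide_left_mono)
    have "x + s \<le> a (Suc m) + cf_real a (Suc (Suc m)) (2 * j)"
      using IH Suc.prems(1)[of "Suc m"] by simp
    then have "1 / (a (Suc m) + cf_real a (Suc (Suc m)) (2 * j)) \<le> 1 / (x + s)"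
      using x s0 by (intro divide_left_mono mult_pos_pos) auto
    then show "a m + 1 / (a (Suc m) + cf_real a (Suc (Suc m)) (2 * j)) \<le> A * x + 1 / (x + s)"
      using Suc.prems(2)[of m] by simp
    have "0 < a m" "0 < a (Suc m) + cf_real a (Suc (Suc m)) (2 * j)"
      using Suc.prems(1)[of m] Suc.prems(1)[of "Suc m"] IH x s0 by auto
    then show "0 < (A * x + 1 / (x + s)) * (a m + 1 / (a (Suc m) + cf_real a (Suc (Suc m)) (2 * j)))"
      using A x s0 by (intro mult_pos_pos add_pos_pos) auto
  qed simp
  also have "1 / (A * x + 1 / (x + s)) = (x + s) / (1 + A * x * (x + s))"
    using x s0 by (simp add: field_simps)
  also have "\<dots> \<ge> s + x / 2"
  proof -
    have "(s + x / 2) * (A * x * (x + s)) \<le> (x + s) * (A * x * (x + s))"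
      using x s0 A by (intro mult_right_mono) auto
    also have "\<dots> = x * (A * (x + s)\<^sup>2)" by (simp add: power2_eq_square algebra_simps)
    also have "\<dots> \<le> x * (1 / 2)" using sx x by (intro mult_left_mono) auto
    finally have "(s + x / 2) * (1 + A * x * (x + s)) \<le> x + s" by (simp add: distrib_left)
    moreover have "1 + A * x * (x + s) > 0" using x s0 A by (intro add_pos_nonneg mult_nonneg_nonneg) auto
    ultimately show ?thesis by (simp add: pos_le_divide_eq)
  qed
  finally show ?case by (simp add: s_def field_simps)
qed simp

text \<open>Here \<open>u x 1\<close> is the value \<open>g\<^sub>+(x)\<close>, and a zero is a
  point with \<open>u x 1 = x / \<kappa>\<close>. Approximating from below by even and from
  above by odd approximants shows that the set \<open>U\<close>, where \<open>u x 1\<close> is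
  larger than \<open>x / \<kappa>\<close>, and the set \<open>V\<close>, where it is smaller,
  are unions of open sets.\<close>

lemma exists_positive_jost_zero:
  assumes r: "\<And>n::nat. r (int n) < 1" "\<And>n::nat. n \<ge> 1 \<Longrightarrow> r (int n) > 0" "r 0 < 0"
    and sm: "summable (\<lambda>n::nat. 1 - r (int n))"
  shows "\<exists>x>0. jost_setting.jost r (of_real x) 0 = 0"
proof -
  define \<kappa> where "\<kappa> = - r 0"
  have \<kappa>: "\<kappa> > 0" using r(3) by (simp add: \<kappa>_def)
  define a where "a = (\<lambda>x k. x / r (int k))"
  have setting: "jost_setting r (of_real x)" if "x > 0" for x
    using r sm that by unfold_locales auto
  define J where "J = (\<lambda>x. jost_setting.jost r (complex_of_real x))"
  define u where "u = (\<lambda>x k. Re (J x (Suc k) / J x k))"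
  have a_pos: "a x k > 0" if "k \<ge> 1" "x > 0" for x k using that r(2)[of k] by (simp add: a_def)
  have lim_c: "(\<lambda>N. complex_of_real (cf_real (a x) k N)) \<longlonglongrightarrow> J x (Suc k) / J x k" if "x > 0" "k \<ge> 1" for x k
  proof -
    interpret jost_setting r "of_real x" by (rule setting[OF that(1)])
    show ?thesis
      using cf_tail_converges(2)[OF that(2)] unfolding cf_approx_of_real[symmetric] a_def J_def by simp
  qed
  have lim: "cf_real (a x) k \<longlonglongrightarrow> u x k" if "x > 0" "k \<ge> 1" for x k
    using tendsto_Re[OF lim_c[OF that]] by (simp add: u_def)
  have J0: "J x 0 = J x 1 * of_real (u x 1 - x / \<kappa>)" "J x 1 \<noteq> 0" if "x > 0" for x
  proof -
    interpret jost_setting r "of_real x" by (rule setting[OF that(1)])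
    have "J x 2 / J x 1 = of_real (u x 1)"
      using LIMSEQ_unique[OF lim_c[of x 1] tendsto_of_real[OF lim[of x 1]]] that by (simp add: numeral_2_eq_2)
    moreover show J1: "J x 1 \<noteq> 0" unfolding J_def by (rule cf_tail_converges(1)) simp
    moreover have "J x 0 = J x 2 + (x / r 0) * J x 1"
      using three_termD[OF jost(1), of 0] by (simp add: J_def numeral_2_eq_2 algebra_simps)
    ultimately show "J x 0 = J x 1 * of_real (u x 1 - x / \<kappa>)"
      by (simp add: \<kappa>_def field_simps)
  qed
  have bracket: "(even N \<longrightarrow> cf_real (a x) 1 N \<le> u x 1) \<and> (odd N \<longrightarrow> u x 1 \<le> cf_real (a x) 1 N)"
    if "x > 0" for x N
    by (rule cf_real_bracket) (use that a_pos lim in auto)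
  have cont: "continuous_on {0<..} (\<lambda>x. cf_real (a x) 1 N - x / \<kappa>)" for N
  proof (intro continuous_intros continuous_cf_real)
    fix k :: nat assume "k \<ge> 1"
    then show "continuous_on {0<..} (\<lambda>x. a x k)"
      unfolding a_def using r(2)[of k] by (intro continuous_intros) auto
  qed (use \<kappa> a_pos in auto)
  define U where "U = (\<Union>N\<in>{N. even N}. {0<..} \<inter> (\<lambda>x. cf_real (a x) 1 N - x / \<kappa>) -` {0<..})"
  define V where "V = (\<Union>N\<in>{N. odd N}. {0<..} \<inter> (\<lambda>x. cf_real (a x) 1 N - x / \<kappa>) -` {..<0})"
  have "open U" unfolding U_def by (intro open_UN ballI continuous_open_preimage cont) auto
  have "open V" unfolding V_def by (intro open_UN ballI continuous_open_preimage cont) auto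
  have U: "u x 1 > x / \<kappa>" if xU: "x \<in> U" for x
  proof -
    obtain N where "even N" "x > 0" "cf_real (a x) 1 N > x / \<kappa>" using xU by (auto simp: U_def)
    then show ?thesis using bracket[of x N] by simp
  qed
  have V: "u x 1 < x / \<kappa>" if xV: "x \<in> V" for x
  proof -
    obtain N where "odd N" "x > 0" "cf_real (a x) 1 N < x / \<kappa>" using xV by (auto simp: V_def)
    then show ?thesis using bracket[of x N] by simp
  qed
  have U': "x \<in> U" if "x > 0" "u x 1 > x / \<kappa>" for x
  proof -
    have "(\<lambda>N. cf_real (a x) 1 (2 * N)) \<longlonglongrightarrow> u x 1"
      by (rule filterlim_compose[OF lim[OF that(1) order_refl]]) (rule filterlim_subseq, simp add: strict_mono_def)
    then have "\<forall>\<^sub>F N in sequentially. cf_real (a x) 1 (2 * N) > x / \<kappa>"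
      using that(2) by (rule order_tendstoD)
    then obtain N where "cf_real (a x) 1 (2 * N) > x / \<kappa>"
      by (auto dest: eventually_happens)
    then show ?thesis using that(1) by (auto simp: U_def intro!: exI[of _ "2 * N"])
  qed
  have V': "x \<in> V" if "x > 0" "u x 1 < x / \<kappa>" for x
  proof -
    have "(\<lambda>N. cf_real (a x) 1 (2 * N + 1)) \<longlonglongrightarrow> u x 1"
      by (rule filterlim_compose[OF lim[OF that(1) order_refl]]) (rule filterlim_subseq, simp add: strict_mono_def)
    then have "\<forall>\<^sub>F N in sequentially. cf_real (a x) 1 (2 * N + 1) < x / \<kappa>"
      using that(2) by (rule order_tendstoD)
    then obtain N where "cf_real (a x) 1 (2 * N + 1) < x / \<kappa>"
      by (auto dest: eventually_happens)
    then show ?thesis using that(1) unfolding V_def by (intro UN_I[of "2 * N + 1"]) auto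
  qed
  have Une: "U \<inter> {0<..} \<noteq> {}"
  proof -
    have "(\<lambda>n. r (int n)) \<longlonglongrightarrow> 1"
      using tendsto_diff[OF tendsto_const[of 1] summable_LIMSEQ_zero[OF sm]] by simp
    then have "(\<lambda>n. 1 / r (int n)) \<longlonglongrightarrow> 1 / 1" by (intro tendsto_intros) auto
    then have "Bseq (\<lambda>n. 1 / r (int n))" by (intro convergent_imp_Bseq convergentI)
    then obtain A where A: "A > 0" "\<And>n. norm (1 / r (int n)) \<le> A" by (auto simp: Bseq_def)
    obtain N :: nat where N: "real N > 2 / \<kappa>" using reals_Archimedean2 by blast
    define B where "B = A + 1"
    \<comment> \<open>The slope \<open>N / 2\<close> beats \<open>1 / \<kappa>\<close>, and \<open>x\<close> is small enough for \<open>N\<close> double steps.\<close>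
    define x where "x = 1 / (2 * B * (real N / 2 + 1))"
    have B: "B > 1" using A by (simp add: B_def)
    have x: "x > 0" using B by (simp add: x_def add_pos_nonneg)
    have ax: "x \<le> a x k" "a x k \<le> B * x" if "k \<ge> 1" for k
    proof -
      have rk: "0 < r (int k)" "r (int k) < 1" using r that by auto
      then show "x \<le> a x k" using x by (simp add: a_def le_divide_eq)
      have "1 / r (int k) \<le> B" using A(2)[of k] rk by (simp add: B_def)
      then have "x * (1 / r (int k)) \<le> x * B" using x by (intro mult_left_mono) auto
      then show "a x k \<le> B * x" by (simp add: a_def mult.commute)
    qed
    have "M / (2 * B * M) = 1 / (2 * B)" if "M > 0" for M :: real using that B by simp
    from this[of "real N / 2 + 1"] have xB: "x * (real N / 2 + 1) = 1 / (2 * B)"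
      by (simp only: x_def times_divide_eq_left mult_1)
    have "B * (x * (real N / 2 + 1))\<^sup>2 = 1 / (4 * B)"
      unfolding xB using B by (simp add: power2_eq_square)
    also have "\<dots> \<le> 1 / 2" using B by (simp add: field_simps)
    finally have "real N * x / 2 \<le> cf_real (a x) 1 (2 * N)"
      using B x ax by (intro cf_real_lower[where A = B]) auto
    moreover have "x / \<kappa> < real N * x / 2"
      using N x \<kappa> by (simp add: field_simps)
    moreover have "cf_real (a x) 1 (2 * N) \<le> u x 1" using bracket[OF x, of "2 * N"] by simp
    ultimately have "x / \<kappa> < u x 1" by linarith
    then show ?thesis using U'[OF x] x by auto
  qed
  have Vne: "V \<inter> {0<..} \<noteq> {}"
  proof -
    define x where "x = 1 + \<kappa>"
    have x: "x > 0" "x > 1" using \<kappa> by (simp_all add: x_def)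
    have "u x 1 \<le> cf_real (a x) 1 1" using bracket[OF x(1), of 1] by simp
    also have "\<dots> = r 1 / x" by (simp add: a_def)
    also have "\<dots> \<le> 1 / x" using r(1)[of 1] x by (intro divide_right_mono) auto
    also have "\<dots> < x / \<kappa>"
    proof -
      have "\<kappa> < x * x" using \<kappa> by (simp add: x_def algebra_simps add_pos_pos)
      then show ?thesis using x \<kappa> by (simp add: field_simps)
    qed
    finally show ?thesis using V'[OF x(1)] x by auto
  qed
  have "\<exists>x>0. u x 1 = x / \<kappa>"
  proof (rule ccontr)
    assume "\<not> (\<exists>x>0. u x 1 = x / \<kappa>)"
    then have "{0<..} \<subseteq> U \<union> V" using U' V' by (metis UnI1 UnI2 greaterThan_iff linorder_cases subsetI)
    moreover have "U \<inter> V \<inter> {0<..} = {}" using U V by force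
    ultimately have "U \<inter> {0<..} = {} \<or> V \<inter> {0<..} = {}"
      using connectedD[of "{0::real<..}" U V] \<open>open U\<close> \<open>open V\<close> by auto
    with Une Vne show False by blast
  qed
  then obtain x where "x > 0" "u x 1 = x / \<kappa>" by blast
  with J0(1)[of x] show ?thesis by (auto simp: J_def)
qed

section \<open>From the line to the plane, and instability\<close>

lemma eigenvalue_in_spectrum:
  assumes "is_eigenvalue T l" and T0: "T (\<lambda>_. 0) = (\<lambda>_. 0)"
  shows "l \<in> op_spectrum T"
proof -
  obtain w where w: "w \<in> op_domain T" "w \<noteq> (\<lambda>_. 0)" "T w = (\<lambda>i. l * w i)"
    using assms(1) by (auto simp: is_eigenvalue_def)
  have "(\<lambda>_. 0) \<in> op_domain T" by (simp add: op_domain_def ell2_def T0)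
  moreover have "(\<lambda>i. T w i - l * w i) = (\<lambda>i. T (\<lambda>_. 0) i - l * (\<lambda>_. 0) i)"
    using w(3) T0 by simp
  ultimately have "\<not> inj_on (\<lambda>w i. T w i - l * w i) (op_domain T)"
    using w(1,2) unfolding inj_on_def by blast
  then show ?thesis by (simp add: op_spectrum_def resolvent_set_def bij_betw_def)
qed

lemma znorm_eq_0_iff: "znorm k = 0 \<longleftrightarrow> k = 0"
  by (cases k) (simp add: znorm_def zero_prod_def)

text \<open>Quadratic growth of \<open>\<parallel>q + n p\<parallel>\<^sup>2\<close> makes
  \<open>1 - \<rho>\<^sub>n\<close> summable.\<close>

lemma znorm_add_zscale_ge: "\<bar>real_of_int n\<bar> * znorm p - znorm q \<le> znorm (q + zscale n p)"
proof -
  define E where "E = (\<lambda>k::zvec. (real_of_int (fst k), real_of_int (snd k)))"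
  have zE: "znorm k = norm (E k)" for k by (simp add: znorm_def E_def)
  have "E (q + zscale n p) = E q + real_of_int n *\<^sub>R E p"
    by (simp add: E_def zscale_def)
  then have "norm (real_of_int n *\<^sub>R E p) - norm (E q) \<le> norm (E (q + zscale n p))"
    using norm_diff_ineq[of "real_of_int n *\<^sub>R E p" "E q"] by (simp add: add.commute)
  then show ?thesis unfolding zE norm_scaleR .
qed

text \<open>The shifts by \<open>p\<close> and \<open>-p\<close> preserve the line \<open>q +
  \<int> p\<close> and its complement, so an eigenvector on the line may be extended by
  zero.\<close>

lemma eigenvalue_on_line:
  assumes eig: "is_eigenvalue (Lq_op \<alpha> p q) l" and p: "p \<noteq> 0"
  shows "is_eigenvalue (L_op \<alpha> p) l"
proof -
  define f where "f = (\<lambda>n. q + zscale n p)"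
  have inj: "inj f"
  proof (rule injI)
    fix m n assume "f m = f n"
    then have "m * fst p = n * fst p" "m * snd p = n * snd p" by (auto simp: f_def zscale_def)
    then show "m = n" using p by (auto simp: prod_eq_iff)
  qed
  have f: "f n - p = f (n - 1)" "f n + p = f (n + 1)" for n
    by (auto simp: f_def zscale_def prod_eq_iff algebra_simps)
  obtain w where w: "w \<in> ell2" "w \<noteq> (\<lambda>_. 0)" "Lq_op \<alpha> p q w = (\<lambda>i. l * w i)"
    using eig by (auto simp: is_eigenvalue_def op_domain_def)
  define W where "W = (\<lambda>k. if k \<in> range f then w (inv f k) else 0)"
  have Wf: "W (f n) = w n" for n using inj by (simp add: W_def)
  have W: "W \<in> ell2"
    by (rule ell2_extend_by_zero[OF inj, of _ "{}"]) (use w(1) Wf in \<open>simp_all add: W_def\<close>)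
  have eq: "L_op \<alpha> p W = (\<lambda>k. l * W k)"
  proof
    fix k
    show "L_op \<alpha> p W k = l * W k"
    proof (cases "k \<in> range f")
      case True
      then obtain n where k: "k = f n" by auto
      show ?thesis
        using fun_cong[OF w(3), of n] unfolding k L_op_def f Wf by (simp add: Lq_op_def f_def)
    next
      case False
      have "k = f (n + 1)" if "k - p = f n" for n
        using f(2)[of n] by (simp flip: that)
      moreover have "k = f (n - 1)" if "k + p = f n" for n
        using f(1)[of n] by (simp flip: that)
      ultimately have "k - p \<notin> range f" "k + p \<notin> range f"
        using False by blast+
      with False show ?thesis by (simp add: L_op_def W_def)
    qed
  qed
  have "W \<noteq> (\<lambda>_. 0)"
  proof
    assume "W = (\<lambda>_. 0)"
    then have "w n = 0" for n using Wf[of n] by simp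
    with w(2) show False by auto
  qed
  then show ?thesis
    unfolding is_eigenvalue_def op_domain_def using W ell2_cmult[OF W] eq by auto
qed

theorem corollary1p3:
  fixes p q :: "int \<times> int" and \<alpha> :: real
  assumes "znorm q < znorm p"
    and "znorm (q - p) = znorm p"
    and "\<forall>n::int. n \<noteq> -1 \<and> n \<noteq> 0 \<longrightarrow> znorm (q + zscale n p) > znorm p"
    and "1 / 2 * \<alpha> * real_of_int (wedge q p) * (1 / (znorm p)\<^sup>2) = 1"
  shows "(\<forall>l::complex. Re l > 0 \<longrightarrow>
            (is_eigenvalue (Lq_op \<alpha> p q) l \<longleftrightarrow> det_K_plus (rho p q) l = 0) \<and>
            (is_eigenvalue (Lq_op \<alpha> p q) l \<longleftrightarrow> det_T_plus (rho p q) l = 0) \<and>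
            (is_eigenvalue (Lq_op \<alpha> p q) l \<longleftrightarrow> evans_plus (rho p q) l = 0) \<and>
            (is_eigenvalue (Lq_op \<alpha> p q) l \<longleftrightarrow> jost_function (rho p q) l = 0) \<and>
            (is_eigenvalue (Lq_op \<alpha> p q) l \<longleftrightarrow> G_plus (rho p q) l = 0)) \<and>
         (\<exists>x::real. x > 0 \<and>
            is_eigenvalue (Lq_op \<alpha> p q) (of_real x) \<and>
            is_eigenvalue (L_op \<alpha> p) (of_real x)) \<and>
         linearly_unstable \<alpha> p"
proof -
  have w0: "wedge q p \<noteq> 0" and zp0: "znorm p \<noteq> 0" using assms(4) by auto
  have p0: "p \<noteq> 0" using zp0 by (simp add: znorm_eq_0_iff)
  have zp: "znorm p > 0" using zp0 by (simp add: znorm_def less_le)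
  have w: "wedge p (q + zscale n p) = - wedge q p" for n
    by (simp add: wedge_def zscale_def algebra_simps)
  have k0: "q + zscale n p \<noteq> 0" for n
  proof
    assume "q + zscale n p = 0"
    then have "wedge p (q + zscale n p) = 0" by (simp add: wedge_def)
    with w w0 show False by simp
  qed
  have zk: "znorm (q + zscale n p) > 0" for n
    using k0[of n] znorm_eq_0_iff[of "q + zscale n p"] by (simp add: znorm_def less_le)
  have coefficient: "\<alpha> * beta p (q + zscale n p) = rho p q n" for n
  proof -
    define P where "P = (znorm p)\<^sup>2"
    define N where "N = (znorm (q + zscale n p))\<^sup>2"
    have PN: "P \<noteq> 0" "N \<noteq> 0" using zp zk[of n] by (simp_all add: P_def N_def)
    have aw: "\<alpha> * real_of_int (wedge q p) = 2 * P"
      using assms(4) PN by (simp add: P_def[symmetric] field_simps)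
    have "\<alpha> * beta p (q + zscale n p) = - ((1 / N - 1 / P) / 2 * (\<alpha> * real_of_int (wedge q p)))"
      using p0 k0 by (simp add: beta_def w P_def N_def)
    also have "\<dots> = 1 - P / N" unfolding aw using PN by (simp add: field_simps)
    finally show ?thesis by (simp add: rho_def P_def N_def)
  qed
  have Lq: "Lq_op \<alpha> p q = weighted_shift_op (rho p q)"
    by (intro ext) (simp add: Lq_op_def weighted_shift_op_def coefficient flip: of_real_mult)
  have rho_lt: "rho p q n < 1" for n using zp zk[of n] by (simp add: rho_def)
  have rho_pos: "rho p q n > 0" if "n \<noteq> -1" "n \<noteq> 0" for n
  proof -
    have "(znorm p)\<^sup>2 < (znorm (q + zscale n p))\<^sup>2"
      using assms(3) that zp by (intro power_strict_mono) auto
    then show ?thesis using zk[of n] by (simp add: rho_def)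
  qed
  have rho0: "rho p q 0 < 0"
  proof -
    have z0: "q + zscale 0 p = q" by (simp add: zscale_def prod_eq_iff)
    have "(znorm q)\<^sup>2 < (znorm p)\<^sup>2"
      using assms(1) zk[of 0] z0 by (intro power_strict_mono) auto
    then show ?thesis using zk[of 0] z0 by (simp add: rho_def)
  qed
  have rho1: "rho p q (-1) = 0"
  proof -
    have "q + zscale (-1) p = q - p" by (simp add: zscale_def prod_eq_iff)
    then show ?thesis using assms(2) zp by (simp add: rho_def)
  qed
  have sm: "summable (\<lambda>n::nat. 1 - rho p q (int n))"
  proof -
    \<comment> \<open>For \<open>n \<ge> 2\<close> the norm of \<open>q + n p\<close> is at least \<open>(n - 1) \<parallel>p\<parallel>\<close>.\<close>
    have "summable (\<lambda>n. 1 - rho p q (int (n + 2)))"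
    proof (rule summable_comparison_test')
      have "summable (\<lambda>n. inverse (real n ^ 2))" by (rule inverse_power_summable) simp
      then show "summable (\<lambda>n. inverse (real (Suc n) ^ 2))" by (subst summable_Suc_iff)
      fix n :: nat
      have "real (Suc n) * znorm p \<le> znorm (q + zscale (int (n + 2)) p)"
        using znorm_add_zscale_ge[of "int (n + 2)" p q] assms(1) by (simp add: algebra_simps)
      then have "(real (Suc n) * znorm p)\<^sup>2 \<le> (znorm (q + zscale (int (n + 2)) p))\<^sup>2"
        using zp by (intro power_mono) auto
      then have "(znorm p)\<^sup>2 / (znorm (q + zscale (int (n + 2)) p))\<^sup>2 \<le> (znorm p)\<^sup>2 / (real (Suc n) * znorm p)\<^sup>2"
        using zp zk[of "int (n + 2)"] by (intro divide_left_mono) auto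
      also have "\<dots> = inverse (real (Suc n) ^ 2)"
        using zp by (simp only: power_mult_distrib) (simp add: inverse_eq_divide)
      finally show "norm (1 - rho p q (int (n + 2))) \<le> inverse (real (Suc n) ^ 2)"
        by (simp add: rho_def)
    qed
    then show ?thesis by (subst (asm) summable_iff_shift)
  qed
  have setting: "two_sided_setting (rho p q) l" if "Re l > 0" for l
    using that rho_lt rho_pos rho0 rho1 sm by unfold_locales auto
  have zeros: "(is_eigenvalue (Lq_op \<alpha> p q) l \<longleftrightarrow> det_K_plus (rho p q) l = 0) \<and>
            (is_eigenvalue (Lq_op \<alpha> p q) l \<longleftrightarrow> det_T_plus (rho p q) l = 0) \<and>
            (is_eigenvalue (Lq_op \<alpha> p q) l \<longleftrightarrow> evans_plus (rho p q) l = 0) \<and>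
            (is_eigenvalue (Lq_op \<alpha> p q) l \<longleftrightarrow> jost_function (rho p q) l = 0) \<and>
            (is_eigenvalue (Lq_op \<alpha> p q) l \<longleftrightarrow> G_plus (rho p q) l = 0)" if "Re l > 0" for l
  proof -
    interpret two_sided_setting "rho p q" l by (rule setting[OF that])
    show ?thesis
      unfolding Lq eigenvalue_iff det_K_plus_eq det_T_plus_eq evans_plus_eq jost_function_eq G_plus_eq
      by simp
  qed
  obtain x where x: "x > 0" "jost_setting.jost (rho p q) (of_real x) 0 = 0"
    using exists_positive_jost_zero[of "rho p q"] rho_lt rho_pos rho0 sm by auto
  have eig: "is_eigenvalue (Lq_op \<alpha> p q) (of_real x)"
  proof -
    interpret two_sided_setting "rho p q" "of_real x" by (rule setting) (simp add: x)
    show ?thesis unfolding Lq eigenvalue_iff by (rule x)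
  qed
  then have eigL: "is_eigenvalue (L_op \<alpha> p) (of_real x)"
    using p0 by (rule eigenvalue_on_line)
  then have "complex_of_real x \<in> op_spectrum (L_op \<alpha> p)"
    by (rule eigenvalue_in_spectrum) (simp add: L_op_def)
  then have "linearly_unstable \<alpha> p"
    unfolding linearly_unstable_def using x(1) by (intro bexI[of _ "of_real x"]) simp_all
  with zeros x eig eigL show ?thesis by blast
qed

end
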